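(* Let $V=V_1+iV_2\in C^\infty(\mathbb{R}^n)$ with $V_1,V_2$ real valued, and let $p(x,\xi)=|\xi|^2+V(x)$ for $(x,\xi)\in\mathbb{R}^{2n}$. Assume that (i) $V_1(x)\ge 0$ for all $x\in\mathbb{R}^n$; (ii) $|V_2(x)|\lesssim 1+|V_2'(x)|^2$ for $x\in\mathbb{R}^n$; (iii) $\partial^\alpha V\in L^\infty(\mathbb{R}^n)$ for all multi-indices $\alpha$ with $|\alpha|\ge 2$. Let $T\ge 0$ be such that $|V_2(x)|-T\lesssim |V_2'(x)|^2$ for $x\in\mathbb{R}^n$, and let $K\in\mathbb{R}$, $K>1$. Then there exist positive constants $h_0$, $A$, $M$ and $c$ such that for all $0<h<h_0$, all $z\in\mathbb{C}$ with $|z|\ge KT+Mh$ and $\operatorname{Re} z\le A h^{2/3}(|z|-T)^{1/3}$, and all $u\in\mathcal{S}(\mathbb{R}^n)$, $$\left\|\left(p^w(x,hD_x)-z\right)u\right\|_{L^2}\ \ge\ c\, h^{2/3}(|z|-T)^{1/3}\|u\|_{L^2}.$$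
   Context: Notation: $f\lesssim g$ means there is a constant $c>0$, independent of the variables, with $f\le cg$. $V_2'$ denotes the gradient of $V_2$, and $\mathcal{S}(\mathbb{R}^n)$ is the Schwartz space. For $0<h\le 1$ the semiclassical Weyl quantization is $$a^w(x,hD_x)u(x)=\int_{\mathbb{R}^{2n}}e^{2\pi i(x-y)\cdot\xi}\,a\!\left(\tfrac{x+y}{2},h\xi\right)u(y)\,dy\,d\xi,$$ so that $p^w(x,hD_x)=-\frac{h^2}{4\pi^2}\Delta+V(x)$. *)

theory Defs
  imports "HOL-Analysis.Analysis"
begin

definition partial_deriv ::
    "'n::finite \<Rightarrow> (real ^ 'n \<Rightarrow> 'b::real_normed_vector) \<Rightarrow> real ^ 'n \<Rightarrow> 'b" where
  "partial_deriv i f x = frechet_derivative f (at x) (axis i 1)"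

text \<open>A multi-index \<open>\<alpha>\<close> is encoded by a list of coordinate indices in which each
  \<open>i\<close> occurs \<open>\<alpha>\<^sub>i\<close> times, so that \<open>|\<alpha>|\<close> is the length of the list. By symmetry of
  the derivatives of smooth functions, the order of the list is irrelevant for them.\<close>

primrec partial_derivs ::
    "'n::finite list \<Rightarrow> (real ^ 'n \<Rightarrow> 'b::real_normed_vector) \<Rightarrow> real ^ 'n \<Rightarrow> 'b" where
  "partial_derivs [] f = f"
| "partial_derivs (i # is) f = partial_deriv i (partial_derivs is f)"

text \<open>Total differentiability at each order makes every iterated partial derivative
  well defined and continuous.\<close>

definition smooth :: "(real ^ 'n::finite \<Rightarrow> 'b::real_normed_vector) \<Rightarrow> bool" where
  "smooth f \<longleftrightarrow> (\<forall>is x. partial_derivs is f differentiable (at x))"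

definition gradient :: "(real ^ 'n::finite \<Rightarrow> real) \<Rightarrow> real ^ 'n \<Rightarrow> real ^ 'n" where
  "gradient f x = (\<chi> i. partial_deriv i f x)"

definition schwartz_space :: "(real ^ 'n::finite \<Rightarrow> complex) set" where
  "schwartz_space = {u. smooth u \<and>
     (\<forall>(\<alpha> :: 'n \<Rightarrow> nat) is.
        bounded (range (\<lambda>x. (\<Prod>i\<in>UNIV. (x $ i) ^ \<alpha> i) *\<^sub>R partial_derivs is u x)))}"

definition L2_norm :: "(real ^ 'n::finite \<Rightarrow> complex) \<Rightarrow> real" where
  "L2_norm f = sqrt (LINT x|lborel. (norm (f x))\<^sup>2)"

text \<open>The semiclassical Weyl quantization \<open>a\<^sup>w(x, hD)\<close>. For symbols that do not decay in
  \<open>\<xi>\<close> the integral over \<open>(y, \<xi>)\<close> is not absolutely convergent; it is read as an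
  iterated integral, first over \<open>y\<close> and then over \<open>\<xi>\<close>. If \<open>u\<close> is a Schwartz function
  and \<open>a\<close> is polynomial in \<open>\<xi>\<close> with smooth coefficients in \<open>x\<close> whose derivatives grow
  at most polynomially, both integrals converge absolutely.\<close>

definition weyl_quantization ::
    "real \<Rightarrow> (real ^ 'n::finite \<Rightarrow> real ^ 'n \<Rightarrow> complex) \<Rightarrow>
     (real ^ 'n \<Rightarrow> complex) \<Rightarrow> real ^ 'n \<Rightarrow> complex" where
  "weyl_quantization h a u x =
     (LINT \<xi>|lborel. LINT y|lborel.
        exp (2 * complex_of_real pi * \<i> * complex_of_real ((x - y) \<bullet> \<xi>)) *
        a (midpoint x y) (h *\<^sub>R \<xi>) * u y)"

end

theory Submission
  imports Defs "HOL-Probability.Probability"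
begin

text \<open>On Schwartz functions, Fourier inversion identifies \<open>p\<^sup>w(x, hD)\<close> with
  \<open>- \<alpha>\<^sup>2 \<Delta> + V\<close>, where \<open>\<alpha> = h / 2\<pi>\<close>. Put \<open>\<rho> = Re z\<close>, \<open>W = V\<^sub>2 - Im z\<close>, \<open>L = |z| - T\<close>,
  \<open>f = (p\<^sup>w - z) u\<close> and use the weight \<open>S = 1 / (|\<nabla>W|\<^sup>2 + L)\<close>. Three integrations by parts suffice:

  \<^item> integrating \<open>Re (f u\<^sup>*)\<close> gives \<open>\<alpha>\<^sup>2 \<parallel>\<nabla>u\<parallel>\<^sup>2 \<le> \<parallel>f\<parallel> \<parallel>u\<parallel> + \<rho> \<parallel>u\<parallel>\<^sup>2\<close>;

  \<^item> in \<open>S |f|\<^sup>2\<close> the real potential commutes with \<open>W\<close> and drops out of the cross term, which is the flux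
    \<open>2 \<alpha>\<^sup>2 \<integral> \<nabla>(S W) \<bullet> Im (u\<^sup>* \<nabla>u)\<close>; this bounds the weighted norm \<open>\<parallel>\<surd>S W u\<parallel>\<close>;

  \<^item> the divergence of \<open>W S \<nabla>W |u|\<^sup>2\<close> bounds \<open>\<integral> S |\<nabla>W|\<^sup>2 |u|\<^sup>2\<close> by \<open>\<parallel>\<surd>S W u\<parallel> (\<parallel>\<nabla>u\<parallel> + \<parallel>u\<parallel> / \<surd>L)\<close>.

  Where \<open>|\<nabla>W|\<^sup>2\<close> is small compared with \<open>L\<close>, the assumption on \<open>T\<close> makes \<open>|W|\<close> at least \<open>L / 4\<close>, so
  \<open>1\<close> is bounded by a multiple of \<open>S |\<nabla>W|\<^sup>2 + S |W|\<close>. If \<open>\<parallel>f\<parallel> < c h\<^bsup>2/3\<^esup> L\<^bsup>1/3\<^esup> \<parallel>u\<parallel>\<close> with small \<open>c\<close>,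
  the three bounds are incompatible because \<open>h \<le> L\<close>.\<close>

subsection \<open>Functions of polynomial growth and of rapid decay\<close>

text \<open>Lebesgue measure on a Euclidean space is a product over \<open>Basis\<close>, while
  vectors here are indexed by \<open>'n\<close>. The injection \<open>axis\<close> translates
  between the two index sets.\<close>

lemma prod_coordinates_eq:
  fixes f :: "'n::finite \<Rightarrow> real \<Rightarrow> 'b::comm_monoid_mult"
  shows "(\<Prod>i\<in>UNIV. f i (x $ i)) =
    (\<Prod>b\<in>Basis. f (inv (\<lambda>i. axis i (1::real)) b) (x \<bullet> b))"
proof -
  have inj: "inj (\<lambda>i::'n. axis i (1::real))"
    by (auto simp: inj_def axis_eq_axis)
  have B: "(Basis :: (real^'n) set) = range (\<lambda>i. axis i 1)"
    by (auto simp: Basis_vec_def)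
  show ?thesis
    unfolding B using inj
    by (subst prod.reindex) (auto simp: inner_axis inv_f_f[OF inj])
qed

text \<open>Fubini for product functions, transported from \<open>Basis\<close> to coordinates. It
  serves two purposes: the integrable majorant with factors \<open>1 / (1 + t\<^sup>2)\<close>, and
  Gaussian integrals in several variables.\<close>

lemma
  fixes f :: "'n::finite \<Rightarrow> real \<Rightarrow> 'b::{real_normed_field,banach,second_countable_topology}"
  assumes f: "\<And>i. integrable lborel (f i)"
  shows integrable_prod_coordinates:
      "integrable lborel (\<lambda>x::real^'n. \<Prod>i\<in>UNIV. f i (x $ i))" (is ?I)
    and integral_prod_coordinates:
      "(LINT x|lborel. (\<Prod>i\<in>UNIV. f i ((x::real^'n) $ i))) = (\<Prod>i\<in>UNIV. (LINT t|lborel. f i t))" (is ?E)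
proof -
  interpret product_sigma_finite "\<lambda>b::real^'n. lborel :: real measure" ..
  let ?F = "\<lambda>b. f (inv (\<lambda>i. axis i (1::real)) b)"
  have inj: "inj (\<lambda>i::'n. axis i (1::real))"
    by (auto simp: inj_def axis_eq_axis)
  have B: "(Basis :: (real^'n) set) = range (\<lambda>i. axis i 1)"
    by (auto simp: Basis_vec_def)
  have m[measurable]: "\<And>i. f i \<in> borel_measurable borel"
    using f by (auto simp: integrable_iff_bounded)
  let ?T = "\<lambda>\<phi>. \<Sum>b\<in>Basis. \<phi> b *\<^sub>R (b::real^'n)"
  have eq: "(\<lambda>\<phi>. \<Prod>i\<in>UNIV. f i (?T \<phi> $ i)) = (\<lambda>\<phi>. \<Prod>b\<in>Basis. ?F b (\<phi> b))"
    by (subst prod_coordinates_eq) (auto simp: inner_sum_left_Basis intro!: ext prod.cong)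
  have T[measurable]: "?T \<in> (\<Pi>\<^sub>M b\<in>Basis. lborel) \<rightarrow>\<^sub>M borel"
    by measurable
  have m2: "(\<lambda>x::real^'n. \<Prod>i\<in>UNIV. f i (x $ i)) \<in> borel_measurable borel"
    by measurable
  have lb: "(lborel :: (real^'n) measure) = distr (\<Pi>\<^sub>M b\<in>Basis. lborel) borel ?T"
    by (rule lborel_eq)
  show ?I
    unfolding lb by (subst integrable_distr_eq[OF T m2])
      (use f in \<open>simp only: eq, auto intro!: product_integrable_prod\<close>)
  have "(LINT x|lborel. (\<Prod>i\<in>UNIV. f i ((x::real^'n) $ i))) = (\<Prod>b\<in>(Basis::(real^'n) set). (LINT t|lborel. ?F b t))"
    unfolding lb integral_distr[OF T m2] eq using f
    by (intro product_integral_prod) auto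
  also have "\<dots> = (\<Prod>i\<in>UNIV. (LINT t|lborel. f i t))"
    unfolding B using inj by (subst prod.reindex) (auto simp: inv_f_f[OF inj])
  finally show ?E .
qed

section \<open>Multipliers of polynomial growth and functions of rapid decay\<close>

definition growing :: "(real ^ 'n::finite \<Rightarrow> 'b::real_normed_vector) \<Rightarrow> bool" where
  "growing f \<longleftrightarrow> continuous_on UNIV f \<and> (\<exists>C N. \<forall>x. norm (f x) \<le> C * (1 + norm x) ^ N)"

text \<open>Continuity is built into both classes, so that measurability comes for free whenever an
  integral is formed. Powers of \<open>1 + norm x\<close> in place of monomials make products with
  growing functions a matter of adding exponents.\<close>

definition rapid :: "(real ^ 'n::finite \<Rightarrow> 'b::real_normed_vector) \<Rightarrow> bool" where
  "rapid f \<longleftrightarrow> continuous_on UNIV f \<and> (\<forall>N. \<exists>C. \<forall>x. norm (f x) * (1 + norm x) ^ N \<le> C)"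

lemma growingI:
  assumes "continuous_on UNIV f" "\<And>x. norm (f x) \<le> C * (1 + norm x) ^ N"
  shows "growing f"
  using assms by (auto simp: growing_def)

lemma growing_bounded:
  assumes "continuous_on UNIV f" "\<And>x. norm (f x) \<le> C"
  shows "growing f"
  by (rule growingI[where C=C and N=0]) (use assms in auto)

lemma growing_const: "growing (\<lambda>x. c)"
  by (rule growing_bounded[where C="norm c"]) auto

lemma rapid_imp_growing:
  assumes "rapid f"
  shows "growing f"
proof -
  from assms obtain C where C: "\<forall>x. norm (f x) * (1 + norm x) ^ 0 \<le> C"
    unfolding rapid_def by blast
  show ?thesis
    by (rule growing_bounded[where C=C]) (use assms C in \<open>auto simp: rapid_def\<close>)
qed

lemma growing_cont: "growing f \<Longrightarrow> continuous_on UNIV f"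
  by (simp add: growing_def)

lemma rapid_cont: "rapid f \<Longrightarrow> continuous_on UNIV f"
  by (simp add: rapid_def)

lemma growingE:
  assumes "growing f"
  obtains C N where "C \<ge> 0" "\<And>x. norm (f x) \<le> C * (1 + norm x) ^ N"
proof -
  from assms obtain C N where C: "\<forall>x. norm (f x) \<le> C * (1 + norm x) ^ N"
    by (auto simp: growing_def)
  have "C \<ge> 0" using C[rule_format, of 0] norm_ge_zero[of "f 0"] by (smt (verit) norm_zero power_one mult_cancel_left1 add_0_right)
  with C that show ?thesis by blast
qed

lemma rapidE:
  assumes "rapid f"
  obtains C where "\<And>x. norm (f x) * (1 + norm x) ^ N \<le> C"
  using assms unfolding rapid_def by blast

lemma growing_le:
  assumes "growing f" "continuous_on UNIV g" "\<And>x. norm (g x) \<le> c * norm (f x)"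
  shows "growing g"
proof -
  from assms obtain C N where C: "\<forall>x. norm (f x) \<le> C * (1 + norm x) ^ N"
    by (auto simp: growing_def)
  show ?thesis
  proof (rule growingI[where C="\<bar>c\<bar> * C" and N=N])
    fix x
    have "norm (g x) \<le> \<bar>c\<bar> * norm (f x)"
      using assms(3)[of x] by (smt (verit) mult_right_mono norm_ge_zero)
    also have "\<dots> \<le> \<bar>c\<bar> * (C * (1 + norm x) ^ N)"
      using C by (intro mult_left_mono) auto
    finally show "norm (g x) \<le> \<bar>c\<bar> * C * (1 + norm x) ^ N" by simp
  qed fact
qed

lemma growing_add:
  fixes f g :: "real ^ 'n::finite \<Rightarrow> 'b::real_normed_vector"
  assumes "growing f" "growing g"
  shows "growing (\<lambda>x. f x + g x)"
proof -
  obtain C N where "C \<ge> 0" and C: "\<And>x. norm (f x) \<le> C * (1 + norm x) ^ N"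
    using growingE[OF assms(1)] by metis
  obtain D M where "D \<ge> 0" and D: "\<And>x. norm (g x) \<le> D * (1 + norm x) ^ M"
    using growingE[OF assms(2)] by metis
  show ?thesis
  proof (rule growingI[where C="C + D" and N="N + M"])
    show "continuous_on UNIV (\<lambda>x. f x + g x)"
      using assms by (auto intro!: continuous_intros simp: growing_def)
    fix x :: "real^'n"
    have 1: "(1 + norm x) ^ N \<le> (1 + norm x) ^ (N + M)" "(1 + norm x) ^ M \<le> (1 + norm x) ^ (N + M)"
      by (intro power_increasing; simp)+
    have "norm (f x + g x) \<le> C * (1 + norm x) ^ N + D * (1 + norm x) ^ M"
      using C[of x] D[of x] norm_triangle_ineq[of "f x" "g x"] by linarith
    also have "\<dots> \<le> C * (1 + norm x) ^ (N + M) + D * (1 + norm x) ^ (N + M)"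
      using 1 \<open>C \<ge> 0\<close> \<open>D \<ge> 0\<close> by (intro add_mono mult_left_mono)
    finally show "norm (f x + g x) \<le> (C + D) * (1 + norm x) ^ (N + M)"
      by (simp add: algebra_simps)
  qed
qed

lemma growing_mult:
  fixes f g :: "real ^ 'n::finite \<Rightarrow> 'b::real_normed_algebra"
  assumes "growing f" "growing g"
  shows "growing (\<lambda>x. f x * g x)"
proof -
  obtain C N where "C \<ge> 0" and C: "\<And>x. norm (f x) \<le> C * (1 + norm x) ^ N"
    using growingE[OF assms(1)] by metis
  obtain D M where "D \<ge> 0" and D: "\<And>x. norm (g x) \<le> D * (1 + norm x) ^ M"
    using growingE[OF assms(2)] by metis
  show ?thesis
  proof (rule growingI[where C="C * D" and N="N + M"])
    show "continuous_on UNIV (\<lambda>x. f x * g x)"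
      using assms by (auto intro!: continuous_intros simp: growing_def)
    fix x :: "real^'n"
    have "norm (f x * g x) \<le> norm (f x) * norm (g x)" by (rule norm_mult_ineq)
    also have "\<dots> \<le> (C * (1 + norm x) ^ N) * (D * (1 + norm x) ^ M)"
      using C[of x] D[of x] \<open>C \<ge> 0\<close> by (intro mult_mono) auto
    finally show "norm (f x * g x) \<le> (C * D) * (1 + norm x) ^ (N + M)"
      by (simp add: power_add mult_ac)
  qed
qed

lemma rapid_le:
  assumes "rapid f" "continuous_on UNIV g" "\<And>x. norm (g x) \<le> c * norm (f x)"
  shows "rapid g"
  unfolding rapid_def
proof (intro conjI allI)
  fix N
  obtain C where C: "\<And>x. norm (f x) * (1 + norm x) ^ N \<le> C"
    using rapidE[OF assms(1)] by metis
  show "\<exists>C. \<forall>x. norm (g x) * (1 + norm x) ^ N \<le> C"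
  proof (intro exI[of _ "\<bar>c\<bar> * C"] allI)
    fix x
    have "norm (g x) \<le> \<bar>c\<bar> * norm (f x)"
      using assms(3)[of x] by (smt (verit) mult_right_mono norm_ge_zero)
    then have "norm (g x) * (1 + norm x) ^ N \<le> \<bar>c\<bar> * norm (f x) * (1 + norm x) ^ N"
      by (intro mult_right_mono) auto
    also have "\<dots> \<le> \<bar>c\<bar> * C"
      using C[of x] by (simp add: mult.assoc mult_left_mono)
    finally show "norm (g x) * (1 + norm x) ^ N \<le> \<bar>c\<bar> * C" .
  qed
qed fact

lemma rapid_add:
  assumes "rapid f" "rapid g"
  shows "rapid (\<lambda>x. f x + g x)"
  unfolding rapid_def
proof (intro conjI allI)
  show "continuous_on UNIV (\<lambda>x. f x + g x)"
    using assms by (auto intro!: continuous_intros simp: rapid_def)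
  fix N
  obtain C where C: "\<And>x. norm (f x) * (1 + norm x) ^ N \<le> C"
    using rapidE[OF assms(1)] by metis
  obtain D where D: "\<And>x. norm (g x) * (1 + norm x) ^ N \<le> D"
    using rapidE[OF assms(2)] by metis
  show "\<exists>C. \<forall>x. norm (f x + g x) * (1 + norm x) ^ N \<le> C"
  proof (intro exI[of _ "C + D"] allI)
    fix x
    have "norm (f x + g x) * (1 + norm x) ^ N \<le> (norm (f x) + norm (g x)) * (1 + norm x) ^ N"
      by (intro mult_right_mono norm_triangle_ineq) auto
    also have "\<dots> \<le> C + D" using C[of x] D[of x] by (simp add: algebra_simps)
    finally show "norm (f x + g x) * (1 + norm x) ^ N \<le> C + D" .
  qed
qed

lemma rapid_mult_growing:
  fixes f g :: "real ^ 'n::finite \<Rightarrow> 'b::real_normed_algebra"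
  assumes "growing f" "rapid g"
  shows "rapid (\<lambda>x. f x * g x)" "rapid (\<lambda>x. g x * f x)"
proof -
  have *: "rapid h" if h: "continuous_on UNIV h" "\<And>x. norm (h x) \<le> norm (f x) * norm (g x)"
    for h :: "real ^ 'n::finite \<Rightarrow> 'b"
    unfolding rapid_def
  proof (intro conjI allI)
    fix N
    obtain C M where "C \<ge> 0" and C: "\<And>x. norm (f x) \<le> C * (1 + norm x) ^ M"
      using growingE[OF assms(1)] by metis
    obtain D where D: "\<And>x. norm (g x) * (1 + norm x) ^ (M + N) \<le> D"
      using rapidE[OF assms(2)] by metis
    show "\<exists>C. \<forall>x. norm (h x) * (1 + norm x) ^ N \<le> C"
    proof (intro exI[of _ "C * D"] allI)
      fix x
      have "norm (h x) * (1 + norm x) ^ N \<le> norm (f x) * norm (g x) * (1 + norm x) ^ N"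
        by (intro mult_right_mono h) auto
      also have "\<dots> \<le> (C * (1 + norm x) ^ M) * norm (g x) * (1 + norm x) ^ N"
        by (intro mult_right_mono C) auto
      also have "\<dots> = C * (norm (g x) * (1 + norm x) ^ (M + N))"
        by (simp add: power_add mult_ac)
      also have "\<dots> \<le> C * D"
        by (intro mult_left_mono D \<open>C \<ge> 0\<close>)
      finally show "norm (h x) * (1 + norm x) ^ N \<le> C * D" .
    qed
  qed fact
  have c: "continuous_on UNIV f" "continuous_on UNIV g"
    using assms by (auto simp: rapid_def growing_def)
  show "rapid (\<lambda>x. f x * g x)"
    by (rule *) (auto intro!: continuous_intros c norm_mult_ineq)
  show "rapid (\<lambda>x. g x * f x)"
    by (rule *) (auto intro!: continuous_intros c norm_mult_ineq order.trans[OF norm_mult_ineq] simp: mult.commute)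
qed

lemma rapid_of_real:
  assumes "rapid f"
  shows "rapid (\<lambda>x. complex_of_real (f x))"
  by (rule rapid_le[where c=1, OF assms])
    (auto intro!: continuous_intros rapid_cont[OF assms])

lemma rapid_Re:
  assumes "rapid f"
  shows "rapid (\<lambda>x. Re (f x))"
  by (rule rapid_le[where c=1, OF assms])
    (auto simp: abs_Re_le_cmod intro!: continuous_intros rapid_cont[OF assms])

lemma rapid_Im:
  assumes "rapid f"
  shows "rapid (\<lambda>x. Im (f x))"
  by (rule rapid_le[where c=1, OF assms])
    (auto simp: abs_Im_le_cmod intro!: continuous_intros rapid_cont[OF assms])

lemma growing_Re:
  assumes "growing f"
  shows "growing (\<lambda>x. Re (f x))"
  by (rule growing_le[where c=1, OF assms])
    (auto simp: abs_Re_le_cmod intro!: continuous_intros growing_cont[OF assms])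

lemma growing_uminus:
  assumes "growing f"
  shows "growing (\<lambda>x. - f x)"
  by (rule growing_le[where c=1, OF assms])
    (auto intro!: continuous_intros growing_cont[OF assms])

lemma growing_diff: "growing f \<Longrightarrow> growing g \<Longrightarrow> growing (\<lambda>x. f x - g x)"
  using growing_add[OF _ growing_uminus, of f g] by simp

lemma rapid_zero: "rapid (\<lambda>x. 0)"
  by (auto simp: rapid_def)

lemma rapid_sum: "(\<And>i. i \<in> I \<Longrightarrow> rapid (f i)) \<Longrightarrow> rapid (\<lambda>x. \<Sum>i\<in>I. f i x)"
  by (induction I rule: infinite_finite_induct) (auto intro: rapid_zero rapid_add)

lemma growing_sum: "(\<And>i. i \<in> I \<Longrightarrow> growing (f i)) \<Longrightarrow> growing (\<lambda>x. \<Sum>i\<in>I. f i x)"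
  by (induction I rule: infinite_finite_induct) (auto intro: growing_const growing_add)

lemma growing_power: "growing f \<Longrightarrow> growing (\<lambda>x. f x ^ k :: 'b::real_normed_algebra_1)"
  by (induction k) (auto intro: growing_const growing_mult)

text \<open>The majorant is the product of \<open>1 / (1 + (x $ i)\<^sup>2)\<close>, integrable
  because each one-dimensional factor is.\<close>

lemma rapid_integrable:
  fixes f :: "real ^ 'n::finite \<Rightarrow> 'b::{banach,second_countable_topology}"
  assumes "rapid f"
  shows "integrable lborel f"
proof -
  let ?w = "\<lambda>x::real^'n. \<Prod>i\<in>UNIV. inverse (1 + (x $ i)\<^sup>2)"
  have w: "integrable lborel ?w"
    by (rule integrable_prod_coordinates)
      (use integrable_inverse_1_plus_square in \<open>simp add: set_integrable_def\<close>)
  have c: "continuous_on UNIV f"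
    using assms by (auto simp: rapid_def)
  \<comment> \<open>Each of the \<open>CARD('n)\<close> factors \<open>1 + (x $ i)\<^sup>2\<close>
    is at most \<open>(1 + norm x)\<^sup>2\<close>, hence the exponent.\<close>
  obtain C where C: "\<And>x. norm (f x) * (1 + norm x) ^ (2 * CARD('n)) \<le> C"
    using rapidE[OF assms(1)] by metis
  show ?thesis
  proof (rule Bochner_Integration.integrable_bound)
    show "integrable lborel (\<lambda>x. C * ?w x)"
      using w by simp
    show "f \<in> borel_measurable lborel"
      using c by (simp add: borel_measurable_continuous_onI)
    show "AE x in lborel. norm (f x) \<le> norm (C * ?w x)"
    proof (rule AE_I2)
      fix x :: "real^'n"
      have "(\<Prod>i\<in>UNIV. 1 + (x $ i)\<^sup>2) \<le> (\<Prod>i\<in>(UNIV::'n set). (1 + norm x)\<^sup>2)"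
      proof (rule prod_mono, safe)
        fix i
        have "\<bar>x $ i\<bar> \<le> norm x" by (rule component_le_norm_cart)
        then have "(x $ i)\<^sup>2 \<le> (norm x)\<^sup>2" by (metis abs_le_square_iff abs_norm_cancel)
        then show "1 + (x $ i)\<^sup>2 \<le> (1 + norm x)\<^sup>2"
          unfolding power2_sum by simp (use norm_ge_zero[of x] in linarith)
      qed (simp add: add_nonneg_nonneg)
      also have "\<dots> = (1 + norm x) ^ (2 * CARD('n))"
        by (simp add: power_mult)
      finally have "norm (f x) * (\<Prod>i\<in>UNIV. 1 + (x $ i)\<^sup>2) \<le> C"
        using C[of x] by (meson mult_left_mono norm_ge_zero order.trans)
      moreover have pos: "(\<Prod>i\<in>UNIV. 1 + (x $ i)\<^sup>2) > 0"
        by (intro prod_pos) (auto intro: add_pos_nonneg)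
      ultimately have "norm (f x) \<le> C / (\<Prod>i\<in>UNIV. 1 + (x $ i)\<^sup>2)"
        by (simp add: field_simps)
      also have "\<dots> = C * ?w x"
        by (simp add: prod_dividef divide_inverse flip: prod_inversef)
      finally show "norm (f x) \<le> norm (C * ?w x)"
        by simp
    qed
  qed
qed

section \<open>Translation invariance and the integral of a derivative\<close>

lemma lborel_translate: "distr lborel borel (\<lambda>x. t + x) = (lborel :: 'a::euclidean_space measure)"
  using lborel_affine[of 1 t] by (simp add: density_1 flip: one_ennreal_def)

lemma integral_translate:
  fixes f :: "'a::euclidean_space \<Rightarrow> 'b::{banach,second_countable_topology}"
  assumes "f \<in> borel_measurable borel"
  shows "(LINT x|lborel. f (t + x)) = (LINT x|lborel. f x)"
  by (subst (2) lborel_translate[of t, symmetric], subst integral_distr) (use assms in auto)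

text \<open>Averaging \<open>g'\<close> over the segment from \<open>x\<close> to
  \<open>x + e\<close> yields \<open>g (x + e) - g x\<close>. Integrate this over \<open>x\<close>:
  by Fubini and translation invariance the left side becomes the integral of \<open>g'\<close>, and
  the right side becomes zero. No boundary terms on large boxes have to be estimated.\<close>

lemma integral_directional_derivative_eq_0:
  fixes g g' :: "real ^ 'n::finite \<Rightarrow> 'b::euclidean_space"
  assumes deriv: "\<And>x. ((\<lambda>s. g (x + s *\<^sub>R e)) has_vector_derivative g' x) (at 0)"
    and "rapid g" "rapid g'"
  shows "(LINT x|lborel. g' x) = 0"
proof -
  have cg: "continuous_on UNIV g" and cg': "continuous_on UNIV g'"
    using assms by (auto simp: rapid_def)
  then have [measurable]: "g \<in> borel_measurable borel" "g' \<in> borel_measurable borel"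
    by (auto intro: borel_measurable_continuous_onI)
  have ig: "integrable lborel g" and ig': "integrable lborel g'"
    using assms by (auto intro: rapid_integrable)
  let ?I = "\<lambda>s. indicator {0..1::real} s"
  \<comment> \<open>The hypothesis speaks of parameter 0 only, but at every base point; moving the
    base point to \<open>x + t *\<^sub>R e\<close> gives the derivative at every
    \<open>t\<close>.\<close>
  have d: "((\<lambda>s. g (x + s *\<^sub>R e)) has_vector_derivative g' (x + t *\<^sub>R e)) (at t within A)" for x t A
  proof -
    have "((\<lambda>s. g ((x + t *\<^sub>R e) + s *\<^sub>R e)) \<circ> (\<lambda>s. s - t) has_vector_derivative (1 *\<^sub>R g' (x + t *\<^sub>R e))) (at t)"
      by (rule vector_diff_chain_at) (auto intro!: derivative_eq_intros simp: deriv)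
    then show ?thesis
      by (auto simp: o_def algebra_simps has_vector_derivative_at_within)
  qed
  have ftc: "(LINT s|lborel. ?I s *\<^sub>R g' (x + s *\<^sub>R e)) = g (x + e) - g x" for x
  proof -
    have "has_bochner_integral lborel (\<lambda>s. indicator {0..1} s *\<^sub>R g' (x + s *\<^sub>R e)) (g (x + 1 *\<^sub>R e) - g (x + 0 *\<^sub>R e))"
      by (rule has_bochner_integral_FTC_Icc)
        (auto intro: d intro!: continuous_on_compose2[OF cg'] continuous_intros)
    then show ?thesis
      by (simp add: has_bochner_integral_iff)
  qed
  have tr: "(LINT x|lborel. norm (g' (x + s *\<^sub>R e))) = (LINT x|lborel. norm (g' x))" for s
    using integral_translate[of "\<lambda>x. norm (g' x)" "s *\<^sub>R e"] by (simp add: add.commute)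
  have tr': "(LINT x|lborel. g' (x + s *\<^sub>R e)) = (LINT x|lborel. g' x)" for s
    using integral_translate[of "\<lambda>x. g' x" "s *\<^sub>R e"] by (simp add: add.commute)
  have itr: "integrable lborel (\<lambda>x. g' (x + v))" for v
  proof -
    have "integrable (distr lborel borel (\<lambda>x. v + x)) g'" by (simp add: lborel_translate ig')
    then show ?thesis by (subst (asm) integrable_distr_eq) (auto simp: add.commute)
  qed
  \<comment> \<open>The integral of the norm over \<open>x\<close> does not depend on
    \<open>s\<close>, so as a function of \<open>s\<close> it is a multiple of the indicator of the
    unit interval.\<close>
  have int: "integrable (lborel \<Otimes>\<^sub>M lborel) (\<lambda>(s, x). ?I s *\<^sub>R g' (x + s *\<^sub>R e))"
  proof (rule lborel_pair.Fubini_integrable)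
    show "(\<lambda>(s, x). ?I s *\<^sub>R g' (x + s *\<^sub>R e)) \<in> borel_measurable (lborel \<Otimes>\<^sub>M lborel)"
      by measurable
    have "(\<lambda>s. LINT x|lborel. norm (case (s, x) of (s, x) \<Rightarrow> ?I s *\<^sub>R g' (x + s *\<^sub>R e))) =
      (\<lambda>s. ?I s *\<^sub>R (LINT x|lborel. norm (g' x)))"
      by (auto simp: tr split: split_indicator)
    then show "integrable lborel (\<lambda>s. LINT x|lborel. norm (case (s, x) of (s, x) \<Rightarrow> ?I s *\<^sub>R g' (x + s *\<^sub>R e)))"
      by simp
    show "AE s in lborel. integrable lborel (\<lambda>x. case (s, x) of (s, x) \<Rightarrow> ?I s *\<^sub>R g' (x + s *\<^sub>R e))"
      using itr by auto
  qed
  have "(LINT x|lborel. g' x) = (LINT s|lborel. (LINT x|lborel. ?I s *\<^sub>R g' (x + s *\<^sub>R e)))"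
    by (simp add: tr')
  also have "\<dots> = (LINT x|lborel. (LINT s|lborel. ?I s *\<^sub>R g' (x + s *\<^sub>R e)))"
    by (rule lborel_pair.Fubini_integral[OF int, symmetric])
  also have "\<dots> = (LINT x|lborel. g (e + x) - g x)"
    by (simp add: ftc add.commute)
  also have "\<dots> = 0"
  proof -
    have "integrable lborel (\<lambda>x. g (e + x))"
    proof -
      have "integrable (distr lborel borel (\<lambda>x. e + x)) g" by (simp add: lborel_translate ig)
      then show ?thesis by (subst (asm) integrable_distr_eq) auto
    qed
    then show ?thesis
      using ig by (simp add: integral_translate)
  qed
  finally show ?thesis .
qed

subsection \<open>Classes of smooth functions\<close>

lemma partial_deriv_eq:
  "(f has_derivative F) (at x) \<Longrightarrow> partial_deriv i f x = F (axis i 1)"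
  unfolding partial_deriv_def using frechet_derivative_at by metis

lemma has_vector_derivative_partial_deriv:
  fixes f :: "real ^ 'n::finite \<Rightarrow> 'b::real_normed_vector"
  assumes "f differentiable (at x)"
  shows "((\<lambda>s. f (x + s *\<^sub>R axis i 1)) has_vector_derivative partial_deriv i f x) (at 0)"
proof -
  have f: "(f has_derivative frechet_derivative f (at x)) (at x)"
    using assms by (simp add: frechet_derivative_works)
  have "((\<lambda>s. x + s *\<^sub>R axis i 1) has_derivative (\<lambda>s. s *\<^sub>R axis i (1::real))) (at 0)"
    by (auto intro!: derivative_eq_intros)
  from diff_chain_at[OF this, of f "frechet_derivative f (at x)"] f
  have "((\<lambda>s. f (x + s *\<^sub>R axis i 1)) has_derivative
      (\<lambda>s. frechet_derivative f (at x) (s *\<^sub>R axis i 1))) (at 0)"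
    by (simp add: o_def)
  then show ?thesis
    using linear_scale[OF linear_frechet_derivative[OF assms]]
    by (simp add: has_vector_derivative_def partial_deriv_def)
qed

lemma frechet_derivative_eq_sum_partial_deriv:
  fixes f :: "real ^ 'n::finite \<Rightarrow> 'b::real_normed_vector"
  assumes "f differentiable (at x)"
  shows "frechet_derivative f (at x) v = (\<Sum>i\<in>UNIV. (v $ i) *\<^sub>R partial_deriv i f x)"
proof -
  have lin: "linear (frechet_derivative f (at x))"
    by (rule linear_frechet_derivative[OF assms])
  have "v = (\<Sum>i\<in>UNIV. (v $ i) *\<^sub>R axis i 1)"
    using basis_expansion[of v] by (simp add: scalar_mult_eq_scaleR)
  then have "frechet_derivative f (at x) v =
      frechet_derivative f (at x) (\<Sum>i\<in>UNIV. (v $ i) *\<^sub>R axis i 1)"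
    by simp
  also have "\<dots> = (\<Sum>i\<in>UNIV. (v $ i) *\<^sub>R partial_deriv i f x)"
    by (simp add: linear_sum[OF lin] linear_scale[OF lin] partial_deriv_def)
  finally show ?thesis .
qed

lemma partial_deriv_add:
  assumes "\<And>x. f differentiable (at x)" "\<And>x. g differentiable (at x)"
  shows "partial_deriv i (\<lambda>x. f x + g x) = (\<lambda>x. partial_deriv i f x + partial_deriv i g x)"
proof
  fix x
  have "((\<lambda>x. f x + g x) has_derivative
      (\<lambda>v. frechet_derivative f (at x) v + frechet_derivative g (at x) v)) (at x)"
    using assms by (intro has_derivative_add) (simp_all add: frechet_derivative_works)
  from partial_deriv_eq[OF this] show "partial_deriv i (\<lambda>x. f x + g x) x = partial_deriv i f x + partial_deriv i g x"
    by (simp add: partial_deriv_def)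
qed

lemma partial_deriv_mult:
  fixes f g :: "real ^ 'n::finite \<Rightarrow> 'b::real_normed_algebra"
  assumes "\<And>x. f differentiable (at x)" "\<And>x. g differentiable (at x)"
  shows "partial_deriv i (\<lambda>x. f x * g x) = (\<lambda>x. f x * partial_deriv i g x + partial_deriv i f x * g x)"
proof
  fix x
  have "((\<lambda>x. f x * g x) has_derivative
      (\<lambda>v. f x * frechet_derivative g (at x) v + frechet_derivative f (at x) v * g x)) (at x)"
    using assms by (intro has_derivative_mult) (simp_all add: frechet_derivative_works)
  from partial_deriv_eq[OF this]
  show "partial_deriv i (\<lambda>x. f x * g x) x = f x * partial_deriv i g x + partial_deriv i f x * g x"
    by (simp add: partial_deriv_def)
qed

lemma partial_deriv_linear:
  assumes "bounded_linear L" "\<And>x. f differentiable (at x)"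
  shows "partial_deriv i (\<lambda>x. L (f x)) = (\<lambda>x. L (partial_deriv i f x))"
    and "(\<lambda>x. L (f x)) differentiable (at x)"
proof -
  have *: "((\<lambda>x. L (f x)) has_derivative (\<lambda>v. L (frechet_derivative f (at x) v))) (at x)" for x
    by (rule bounded_linear.has_derivative[OF assms(1)])
      (use assms(2) in \<open>simp add: frechet_derivative_works\<close>)
  show "partial_deriv i (\<lambda>x. L (f x)) = (\<lambda>x. L (partial_deriv i f x))"
    by (rule ext, subst partial_deriv_eq[OF *]) (simp add: partial_deriv_def)
  show "(\<lambda>x. L (f x)) differentiable (at x)"
    using * unfolding differentiable_def by blast
qed

text \<open>The Weyl quantization evaluates the potential at \<open>midpoint x y\<close>, and for
  fixed \<open>x\<close> this factor must be differentiated in \<open>y\<close>.\<close>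

lemma partial_deriv_midpoint:
  fixes f :: "real ^ 'n::finite \<Rightarrow> 'b::real_normed_vector"
  assumes "\<And>x. f differentiable (at x)"
  shows "partial_deriv i (\<lambda>y. f (midpoint x y)) = (\<lambda>y. (1/2) *\<^sub>R partial_deriv i f (midpoint x y))"
    and "(\<lambda>y. f (midpoint x y)) differentiable (at y)"
proof -
  have *: "((\<lambda>y. f (midpoint x y)) has_derivative
      (\<lambda>v. frechet_derivative f (at (midpoint x y)) ((1/2) *\<^sub>R v))) (at y)" for y
  proof -
    have "((\<lambda>y. inverse 2 *\<^sub>R (x + y)) has_derivative (\<lambda>v. inverse 2 *\<^sub>R (0 + v))) (at y)"
      by (intro has_derivative_scaleR_right has_derivative_add has_derivative_const has_derivative_ident)
    then have m: "(midpoint x has_derivative (\<lambda>v. (1/2) *\<^sub>R v)) (at y)"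
      by (simp add: midpoint_def[abs_def] inverse_eq_divide)
    have "(f has_derivative frechet_derivative f (at (midpoint x y))) (at (midpoint x y))"
      using assms by (simp add: frechet_derivative_works)
    from diff_chain_at[OF m this] show ?thesis by (simp add: o_def)
  qed
  show "partial_deriv i (\<lambda>y. f (midpoint x y)) = (\<lambda>y. (1/2) *\<^sub>R partial_deriv i f (midpoint x y))"
    by (rule ext, subst partial_deriv_eq[OF *])
      (simp add: partial_deriv_def linear_scale[OF linear_frechet_derivative[OF assms]])
  show "(\<lambda>y. f (midpoint x y)) differentiable (at y)"
    using * by (auto simp: differentiable_def)
qed

section \<open>Smooth functions all of whose derivatives lie in a given class\<close>

primrec smooth_upto ::
    "((real ^ 'n::finite \<Rightarrow> 'b::real_normed_vector) \<Rightarrow> bool) \<Rightarrow> nat \<Rightarrow> (real ^ 'n \<Rightarrow> 'b) \<Rightarrow> bool" where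
  "smooth_upto Q 0 f \<longleftrightarrow> (\<forall>x. f differentiable (at x)) \<and> Q f"
| "smooth_upto Q (Suc k) f \<longleftrightarrow>
     (\<forall>x. f differentiable (at x)) \<and> Q f \<and> (\<forall>i. smooth_upto Q k (partial_deriv i f))"

definition smooth_in :: "((real ^ 'n::finite \<Rightarrow> 'b::real_normed_vector) \<Rightarrow> bool) \<Rightarrow> (real ^ 'n \<Rightarrow> 'b) \<Rightarrow> bool" where
  "smooth_in Q f \<longleftrightarrow> (\<forall>k. smooth_upto Q k f)"

lemma partial_derivs_snoc: "partial_derivs (is @ [i]) f = partial_derivs is (partial_deriv i f)"
  by (induction "is") auto

text \<open>\<open>smooth_upto\<close> differentiates the function itself first, so that product and
  chain rules can be applied once per induction step; \<open>partial_derivs\<close> adds derivatives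
  on the outside. Peeling off the last list entry, which is the innermost derivative, reconciles the
  two.\<close>

lemma smooth_upto_iff:
  "smooth_upto Q k f \<longleftrightarrow>
    (\<forall>is. length is \<le> k \<longrightarrow> (\<forall>x. partial_derivs is f differentiable (at x)) \<and> Q (partial_derivs is f))"
proof (induction k arbitrary: f)
  case (Suc k)
  show ?case (is "?l \<longleftrightarrow> ?r")
  proof
    assume l: ?l
    show ?r
    proof (intro allI impI)
      fix "is" :: "'a list"
      assume "length is \<le> Suc k"
      show "(\<forall>x. partial_derivs is f differentiable (at x)) \<and> Q (partial_derivs is f)"
      proof (cases "is" rule: rev_cases)
        case Nil
        then show ?thesis using l by simp
      next
        case (snoc js i)
        have "smooth_upto Q k (partial_deriv i f)" using l by simp
        then show ?thesis
          using \<open>length is \<le> Suc k\<close> unfolding snoc partial_derivs_snoc Suc.IH by simp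
      qed
    qed
  next
    assume r: ?r
    have "smooth_upto Q k (partial_deriv i f)" for i
      unfolding Suc.IH using r[rule_format, of "_ @ [i]"] by (auto simp: partial_derivs_snoc)
    then show ?l
      using r[rule_format, of "[]"] by simp
  qed
qed auto

lemma smooth_in_iff: "smooth_in Q f \<longleftrightarrow> smooth f \<and> (\<forall>is. Q (partial_derivs is f))"
  unfolding smooth_in_def smooth_upto_iff smooth_def by auto

lemma smooth_in_partial_deriv: "smooth_in Q f \<Longrightarrow> smooth_in Q (partial_deriv i f)"
  unfolding smooth_in_def by (metis smooth_upto.simps(2))

lemma smooth_in_base: "smooth_in Q f \<Longrightarrow> Q f"
  unfolding smooth_in_def by (metis smooth_upto.simps(1))

lemma smooth_in_differentiable: "smooth_in Q f \<Longrightarrow> f differentiable (at x)"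
  unfolding smooth_in_def by (metis smooth_upto.simps(1))

lemma smooth_upto_Suc_imp: "smooth_upto Q (Suc k) f \<Longrightarrow> smooth_upto Q k f"
  by (simp add: smooth_upto_iff)

lemma smooth_upto_add:
  assumes "\<And>f g. Q f \<Longrightarrow> Q g \<Longrightarrow> Q (\<lambda>x. f x + g x)"
    and "smooth_upto Q k f" "smooth_upto Q k g"
  shows "smooth_upto Q k (\<lambda>x. f x + g x)"
  using assms(2,3) by (induction k arbitrary: f g) (auto simp: assms(1) partial_deriv_add)

lemma smooth_in_add:
  assumes "\<And>f g. Q f \<Longrightarrow> Q g \<Longrightarrow> Q (\<lambda>x. f x + g x)"
    and "smooth_in Q f" "smooth_in Q g"
  shows "smooth_in Q (\<lambda>x. f x + g x)"
  using assms smooth_upto_add[of Q] by (auto simp: smooth_in_def)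

text \<open>By the Leibniz rule both terms of a derivative are again a product of a factor from
  \<open>Q\<close> and one from \<open>R\<close>, so the induction on the order closes. It is
  applied with \<open>growing\<close> as \<open>Q\<close> and \<open>rapid\<close> as
  \<open>R\<close>.\<close>

lemma smooth_in_mult:
  fixes f g :: "real ^ 'n::finite \<Rightarrow> 'b::real_normed_algebra"
  assumes Q: "\<And>f g. Q f \<Longrightarrow> R g \<Longrightarrow> R (\<lambda>x. f x * g x)"
    and R: "\<And>f g. R f \<Longrightarrow> R g \<Longrightarrow> R (\<lambda>x. f x + g x)"
    and "smooth_in Q f" "smooth_in R g"
  shows "smooth_in R (\<lambda>x. f x * g x)"
proof -
  have "smooth_upto R k (\<lambda>x. f x * g x)" if "smooth_upto Q k f" "smooth_upto R k g" for k f g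
    using that
  proof (induction k arbitrary: f g)
    case 0
    then show ?case by (auto intro: Q)
  next
    case (Suc k)
    then have d: "\<And>x. f differentiable (at x)" "\<And>x. g differentiable (at x)"
      by auto
    \<comment> \<open>Each Leibniz term leaves one factor undifferentiated, and that factor must be
      lowered to order \<open>k\<close> to match the other.\<close>
    have "smooth_upto Q k f" "smooth_upto R k g"
      using Suc.prems smooth_upto_Suc_imp by blast+
    then have "smooth_upto R k (\<lambda>x. f x * partial_deriv i g x)"
        "smooth_upto R k (\<lambda>x. partial_deriv i f x * g x)" for i
      using Suc.prems by (auto intro!: Suc.IH)
    then have "smooth_upto R k (\<lambda>x. f x * partial_deriv i g x + partial_deriv i f x * g x)" for i
      by (intro smooth_upto_add[where Q=R, OF R])
    then show ?case
      using d Suc.prems by (auto simp: partial_deriv_mult Q)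
  qed
  then show ?thesis using assms by (auto simp: smooth_in_def)
qed

lemma smooth_in_linear:
  assumes "bounded_linear L" "\<And>f. Q f \<Longrightarrow> R (\<lambda>x. L (f x))" "smooth_in Q f"
  shows "smooth_in R (\<lambda>x. L (f x))"
proof -
  have "smooth_upto R k (\<lambda>x. L (f x))" if "smooth_upto Q k f" for k f
    using that
  proof (induction k arbitrary: f)
    case 0
    then show ?case
      using assms(2) by (simp add: partial_deriv_linear(2)[OF assms(1)])
  next
    case (Suc k)
    then show ?case
      using assms(2) by (simp add: partial_deriv_linear[OF assms(1)])
  qed
  then show ?thesis using assms by (auto simp: smooth_in_def)
qed

section \<open>Membership of potentials and Schwartz functions in the smooth classes\<close>

lemma growing_midpoint:
  assumes "growing f"
  shows "growing (\<lambda>y. f (midpoint x y))"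
proof -
  obtain C N where "C \<ge> 0" and C: "\<And>x. norm (f x) \<le> C * (1 + norm x) ^ N"
    using growingE[OF assms] by metis
  show ?thesis
  proof (rule growingI[where C="C * (1 + norm x) ^ N" and N=N])
    show "continuous_on UNIV (\<lambda>y. f (midpoint x y))"
      by (rule continuous_on_compose2[OF growing_cont[OF assms]])
        (auto simp: midpoint_def intro!: continuous_intros)
    fix y
    have "norm (midpoint x y) \<le> norm x + norm y"
      using norm_triangle_ineq[of x y] norm_ge_zero[of x] norm_ge_zero[of y]
      by (simp add: midpoint_def del: norm_ge_zero)
    then have "1 + norm (midpoint x y) \<le> (1 + norm x) * (1 + norm y)"
      using mult_nonneg_nonneg[OF norm_ge_zero[of x] norm_ge_zero[of y]]
      unfolding distrib_left distrib_right by linarith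
    then have "(1 + norm (midpoint x y)) ^ N \<le> ((1 + norm x) * (1 + norm y)) ^ N"
      by (intro power_mono) auto
    then have "C * (1 + norm (midpoint x y)) ^ N \<le> C * ((1 + norm x) * (1 + norm y)) ^ N"
      using \<open>C \<ge> 0\<close> by (rule mult_left_mono)
    with C[of "midpoint x y"]
    show "norm (f (midpoint x y)) \<le> C * (1 + norm x) ^ N * (1 + norm y) ^ N"
      by (simp add: power_mult_distrib)
  qed
qed

lemma growing_scaleR:
  assumes "growing f"
  shows "growing (\<lambda>x. c *\<^sub>R f x)"
  by (rule growing_le[where c="\<bar>c\<bar>", OF assms]) (auto intro!: continuous_intros growing_cont[OF assms])

lemma smooth_in_growing_midpoint:
  assumes "smooth_in growing f"
  shows "smooth_in growing (\<lambda>y. f (midpoint x y))"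
proof -
  \<comment> \<open>The scalar \<open>c\<close> is generalized because every derivative contributes
    a factor 1/2.\<close>
  have "smooth_upto growing k (\<lambda>y. c *\<^sub>R f (midpoint x y))" if "smooth_upto growing k f" for k f c
    using that
  proof (induction k arbitrary: f c)
    case 0
    then have d: "\<And>x. f differentiable (at x)" by auto
    have "growing (\<lambda>y. c *\<^sub>R f (midpoint x y))"
      by (rule growing_scaleR[OF growing_midpoint]) (use 0 in simp)
    then show ?case
      using differentiable_scaleR[OF _ partial_deriv_midpoint(2)[OF d]] by simp
  next
    case (Suc k)
    then have d: "\<And>x. f differentiable (at x)" by auto
    have "partial_deriv i (\<lambda>y. c *\<^sub>R f (midpoint x y)) = (\<lambda>y. (c / 2) *\<^sub>R partial_deriv i f (midpoint x y))" for i
      using partial_deriv_linear(1)[OF bounded_linear_scaleR_right[of c] partial_deriv_midpoint(2)[OF d], of i x]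
        partial_deriv_midpoint(1)[OF d] by simp
    moreover have "growing (\<lambda>y. c *\<^sub>R f (midpoint x y))"
      by (rule growing_scaleR[OF growing_midpoint]) (use Suc.prems in simp)
    ultimately show ?case
      using Suc differentiable_scaleR[OF _ partial_deriv_midpoint(2)[OF d]] by simp
  qed
  from this[of _ f 1] show ?thesis using assms by (auto simp: smooth_in_def)
qed

text \<open>The mean value inequality between 0 and \<open>x\<close>: growth of degree
  \<open>N\<close> for the gradient gives growth of degree \<open>N + 1\<close> for the
  function.\<close>

lemma growing_of_partial_derivs:
  fixes f :: "real ^ 'n::finite \<Rightarrow> 'b::real_normed_vector"
  assumes d: "\<And>x. f differentiable (at x)" and g: "\<And>i. growing (partial_deriv i f)"
  shows "growing f"
proof -
  have "growing (\<lambda>x::real^'n. \<Sum>i\<in>UNIV. norm (partial_deriv i f x))"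
  proof (rule growing_sum)
    show "growing (\<lambda>x::real^'n. norm (partial_deriv i f x))" for i
      by (rule growing_le[OF g[of i], where c=1]) (auto intro!: continuous_intros growing_cont[OF g])
  qed
  then obtain C N where "C \<ge> 0" and C: "\<And>x. norm (\<Sum>i\<in>UNIV. norm (partial_deriv i f x)) \<le> C * (1 + norm x) ^ N"
    using growingE by metis
  \<comment> \<open>The ball of radius \<open>norm x\<close> about 0 is convex and contains both
    endpoints, and on it the growth bound of the gradient is largest at the boundary.\<close>
  have lip: "norm (f x - f 0) \<le> C * (1 + norm x) ^ N * norm (x - 0)" for x
  proof (rule differentiable_bound[where S="cball 0 (norm x)" and f'="\<lambda>x. frechet_derivative f (at x)"])
    fix y :: "real^'n" assume y: "y \<in> cball 0 (norm x)"
    show "(f has_derivative frechet_derivative f (at y)) (at y within cball 0 (norm x))"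
      using d frechet_derivative_works has_derivative_at_withinI by blast
    have "(1 + norm y) ^ N \<le> (1 + norm x) ^ N"
      using y by (intro power_mono) auto
    then have "C * (1 + norm y) ^ N \<le> C * (1 + norm x) ^ N"
      using \<open>C \<ge> 0\<close> by (rule mult_left_mono)
    then have B: "(\<Sum>i\<in>UNIV. norm (partial_deriv i f y)) \<le> C * (1 + norm x) ^ N"
      using C[of y] by (simp add: abs_of_nonneg sum_nonneg)
    show "onorm (frechet_derivative f (at y)) \<le> C * (1 + norm x) ^ N"
    proof (rule onorm_le)
      fix v
      have "norm (frechet_derivative f (at y) v) \<le> (\<Sum>i\<in>UNIV. norm ((v $ i) *\<^sub>R partial_deriv i f y))"
        unfolding frechet_derivative_eq_sum_partial_deriv[OF d] by (rule norm_sum)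
      also have "\<dots> \<le> (\<Sum>i\<in>UNIV. norm v * norm (partial_deriv i f y))"
        by (intro sum_mono) (simp add: component_le_norm_cart mult_right_mono)
      also have "\<dots> \<le> norm v * (C * (1 + norm x) ^ N)"
        unfolding sum_distrib_left[symmetric] by (intro mult_left_mono B) auto
      finally show "norm (frechet_derivative f (at y) v) \<le> C * (1 + norm x) ^ N * norm v"
        by (simp add: mult.commute)
    qed
  qed auto
  show ?thesis
  proof (rule growingI[where C="norm (f 0) + C" and N="Suc N"])
    show "continuous_on UNIV f"
      using d by (simp add: continuous_on_eq_continuous_at differentiable_imp_continuous_within)
    fix x :: "real^'n"
    have 1: "1 \<le> (1 + norm x) ^ Suc N" by (rule one_le_power) simp
    have 2: "norm (f x) \<le> norm (f 0) + norm (f x - f 0)"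
      using norm_triangle_ineq[of "f 0" "f x - f 0"] by simp
    have "C * (1 + norm x) ^ N * norm x \<le> C * (1 + norm x) ^ N * (1 + norm x)"
      using \<open>C \<ge> 0\<close> by (intro mult_left_mono) auto
    moreover have "norm (f 0) * 1 \<le> norm (f 0) * (1 + norm x) ^ Suc N"
      by (intro mult_left_mono 1) auto
    ultimately show "norm (f x) \<le> (norm (f 0) + C) * (1 + norm x) ^ Suc N"
      using lip[of x] 2 by (simp add: algebra_simps)
  qed
qed

text \<open>Assumption (iii) controls only derivatives of order at least two. The lower orders are
  recovered by integrating downwards, each integration raising the polynomial degree by one.\<close>

lemma smooth_in_growing_of_bounded_derivs:
  fixes f :: "real ^ 'n::finite \<Rightarrow> 'b::real_normed_vector"
  assumes f: "smooth f" and b: "\<And>is. length is \<ge> m \<Longrightarrow> bounded (range (partial_derivs is f))"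
  shows "smooth_in growing f"
proof -
  have cont: "continuous_on UNIV (partial_derivs is f)" for "is"
    using f by (auto simp: smooth_def continuous_on_eq_continuous_at differentiable_imp_continuous_within)
  have "growing (partial_derivs is f)" for "is"
  \<comment> \<open>The induction counts the derivatives still missing to reach order
    \<open>m\<close>; consing one more index lowers this number.\<close>
  proof (induction "m - length is" arbitrary: "is")
    case 0
    then obtain C where "\<And>x. norm (partial_derivs is f x) \<le> C"
      using b[of "is"] by (auto simp: bounded_iff)
    then show ?case by (rule growing_bounded[OF cont])
  next
    case (Suc k)
    show ?case
    proof (rule growing_of_partial_derivs)
      show "partial_derivs is f differentiable (at x)" for x
        using f by (simp add: smooth_def)
      show "growing (partial_deriv i (partial_derivs is f))" for i
        using Suc.hyps(1)[of "i # is"] Suc.hyps(2) by simp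
    qed
  qed
  then show ?thesis using f by (simp add: smooth_in_iff)
qed

text \<open>The monomial seminorms for pure powers of a single coordinate already suffice, because
  the coordinate of largest modulus is comparable to the norm.\<close>

lemma schwartz_space_smooth_in_rapid:
  fixes u :: "real ^ 'n::finite \<Rightarrow> complex"
  assumes "u \<in> schwartz_space"
  shows "smooth_in rapid u"
  unfolding smooth_in_iff
proof (intro conjI allI)
  show sm: "smooth u" using assms by (simp add: schwartz_space_def)
  fix "is" :: "'n list"
  let ?f = "partial_derivs is u"
  show "rapid ?f"
    unfolding rapid_def
  proof (intro conjI allI)
    show "continuous_on UNIV ?f"
      using sm by (auto simp: smooth_def continuous_on_eq_continuous_at differentiable_imp_continuous_within)
    fix N :: nat
    have bd: "bounded (range (\<lambda>x. (\<Prod>i\<in>UNIV. (x $ i) ^ \<alpha> i) *\<^sub>R ?f x))" for \<alpha>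
      using assms by (auto simp: schwartz_space_def)
    have "\<exists>D. \<forall>x. \<bar>x $ j\<bar> ^ N * norm (?f x) \<le> D" for j
    proof -
      have "(\<Prod>i\<in>UNIV. (x $ i) ^ (if i = j then N else 0)) = (x $ j) ^ N" for x :: "real^'n"
        by (subst prod.remove[of _ j]) auto
      then show ?thesis
        using bd[of "\<lambda>i. if i = j then N else 0"] by (auto simp: bounded_iff power_abs)
    qed
    then obtain D where D: "\<And>j x. \<bar>x $ j\<bar> ^ N * norm (?f x) \<le> D j"
      by metis
    obtain D0 where D0: "\<And>x. norm (?f x) \<le> D0"
      using bd[of "\<lambda>i. 0"] by (auto simp: bounded_iff)
    show "\<exists>C. \<forall>x. norm (?f x) * (1 + norm x) ^ N \<le> C"
    proof (intro exI allI)
      fix x :: "real^'n"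
      let ?m = "Max (range (\<lambda>i. \<bar>x $ i\<bar>))"
      obtain j where j: "?m = \<bar>x $ j\<bar>"
        using Max_in[of "range (\<lambda>i. \<bar>x $ i\<bar>)"] by (metis UNIV_not_empty empty_is_image finite imageE finite_imageI)
      have m: "\<bar>x $ i\<bar> \<le> \<bar>x $ j\<bar>" for i
        unfolding j[symmetric] by (rule Max_ge) auto
      have "norm x \<le> (\<Sum>i\<in>UNIV. \<bar>x $ i\<bar>)" by (rule norm_le_l1_cart)
      also have "\<dots> \<le> real CARD('n) * \<bar>x $ j\<bar>"
        using sum_bounded_above[of UNIV "\<lambda>i. \<bar>x $ i\<bar>" "\<bar>x $ j\<bar>"] m by simp
      finally have nx: "norm x \<le> real CARD('n) * \<bar>x $ j\<bar>" .
      have "(1 + norm x) ^ N \<le> (2 * max 1 (norm x)) ^ N"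
        by (intro power_mono) auto
      also have "\<dots> = 2 ^ N * (max 1 (norm x)) ^ N" by (simp add: power_mult_distrib)
      also have "\<dots> \<le> 2 ^ N * (1 + norm x ^ N)"
        by (intro mult_left_mono) (auto simp: max_def)
      also have "\<dots> \<le> 2 ^ N * (1 + real CARD('n) ^ N * \<bar>x $ j\<bar> ^ N)"
        using power_mono[OF nx, of N] by (simp add: power_mult_distrib)
      finally have "norm (?f x) * (1 + norm x) ^ N \<le> norm (?f x) * (2 ^ N * (1 + real CARD('n) ^ N * \<bar>x $ j\<bar> ^ N))"
        by (rule mult_left_mono) auto
      also have "\<dots> = 2 ^ N * (norm (?f x) + real CARD('n) ^ N * (\<bar>x $ j\<bar> ^ N * norm (?f x)))"
        by (simp add: algebra_simps)
      \<comment> \<open>The maximal coordinate \<open>j\<close> varies with \<open>x\<close>;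
        summing over all coordinates gives a constant independent of it.\<close>
      also have "\<dots> \<le> 2 ^ N * (D0 + real CARD('n) ^ N * (\<Sum>j\<in>UNIV. \<bar>D j\<bar>))"
      proof (intro mult_left_mono add_mono D0)
        have "D j \<le> \<bar>D j\<bar>" by simp
        also have "\<dots> \<le> (\<Sum>j\<in>UNIV. \<bar>D j\<bar>)" by (rule member_le_sum) auto
        finally show "\<bar>x $ j\<bar> ^ N * norm (?f x) \<le> (\<Sum>j\<in>UNIV. \<bar>D j\<bar>)"
          using D[of x j] by linarith
      qed auto
      finally show "norm (?f x) * (1 + norm x) ^ N \<le> 2 ^ N * (D0 + real CARD('n) ^ N * (\<Sum>j\<in>UNIV. \<bar>D j\<bar>))" .
    qed
  qed
qed

lemma smooth_in_rapid_linear: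
  assumes "bounded_linear L" "smooth_in rapid f"
  shows "smooth_in rapid (\<lambda>x. L (f x))"
proof (rule smooth_in_linear[OF assms(1) _ assms(2)])
  fix f :: "real ^ 'c \<Rightarrow> 'a" assume f: "rapid f"
  obtain K where K: "\<And>x. norm (L x) \<le> norm x * K"
    using bounded_linear.bounded[OF assms(1)] by auto
  show "rapid (\<lambda>x. L (f x))"
    by (rule rapid_le[where c=K, OF f])
      (auto intro!: bounded_linear.continuous_on[OF assms(1)] rapid_cont[OF f] simp: K mult.commute[of K])
qed

lemma smooth_in_growing_linear:
  assumes "bounded_linear L" "smooth_in growing f"
  shows "smooth_in growing (\<lambda>x. L (f x))"
proof (rule smooth_in_linear[OF assms(1) _ assms(2)])
  fix f :: "real ^ 'c \<Rightarrow> 'a" assume f: "growing f"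
  obtain K where K: "\<And>x. norm (L x) \<le> norm x * K"
    using bounded_linear.bounded[OF assms(1)] by auto
  show "growing (\<lambda>x. L (f x))"
    by (rule growing_le[where c=K, OF f])
      (auto intro!: bounded_linear.continuous_on[OF assms(1)] growing_cont[OF f] simp: K mult.commute[of K])
qed

subsection \<open>Fourier inversion\<close>

text \<open>The factor \<open>2 * pi\<close> sits in the exponent, as in
  \<open>weyl_quantization\<close>, so that the inversion formula carries no constant.\<close>

definition fourier :: "(real ^ 'n::finite \<Rightarrow> complex) \<Rightarrow> real ^ 'n \<Rightarrow> complex" where
  "fourier f \<xi> = (LINT y|lborel. exp (- (2 * pi * \<i>) * complex_of_real (y \<bullet> \<xi>)) * f y)"

lemma growing_exp_ii: "growing (\<lambda>y::real^'n::finite. exp (- (2 * pi * \<i>) * complex_of_real (y \<bullet> \<xi>)))"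
  by (rule growing_bounded[where C=1]) (auto intro!: continuous_intros simp: norm_exp_eq_Re)

lemma rapid_exp_ii_mult:
  "rapid f \<Longrightarrow> rapid (\<lambda>y::real^'n::finite. exp (- (2 * pi * \<i>) * complex_of_real (y \<bullet> \<xi>)) * f y)"
  by (rule rapid_mult_growing(1)[OF growing_exp_ii])

lemma fourier_add:
  assumes "rapid f" "rapid g"
  shows "fourier (\<lambda>x. f x + g x) \<xi> = fourier f \<xi> + fourier g \<xi>"
  unfolding fourier_def distrib_left
  by (intro Bochner_Integration.integral_add rapid_integrable rapid_exp_ii_mult assms)

lemma fourier_cmult: "fourier (\<lambda>x. c * f x) \<xi> = c * fourier f \<xi>"
  unfolding fourier_def mult.left_commute[of _ c] by simp

lemma norm_fourier_le: "norm (fourier f \<xi>) \<le> (LINT y|lborel. norm (f y))"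
  unfolding fourier_def
  by (rule order.trans[OF integral_norm_bound]) (simp add: norm_mult norm_exp_eq_Re)

text \<open>The derivative of the exponential times \<open>f\<close> integrates to zero; its two
  terms are the transform of the derivative and a multiple of the transform of
  \<open>f\<close>.\<close>

lemma fourier_partial_deriv:
  fixes f :: "real ^ 'n::finite \<Rightarrow> complex"
  assumes f: "smooth_in rapid f"
  shows "fourier (partial_deriv i f) \<xi> = (2 * pi * \<i>) * (\<xi> $ i) * fourier f \<xi>"
proof -
  let ?e = "\<lambda>y. exp (- (2 * pi * \<i>) * complex_of_real (y \<bullet> \<xi>))"
  let ?c = "- (2 * pi * \<i>) * complex_of_real (\<xi> $ i)"
  let ?g = "\<lambda>y. ?e y * f y"
  let ?g' = "\<lambda>y. ?e y * partial_deriv i f y + ?c * (?e y * f y)"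
  have r: "rapid ?g" "rapid (\<lambda>y. ?e y * partial_deriv i f y)"
    by (rule rapid_exp_ii_mult[OF smooth_in_base[OF f]],
        rule rapid_exp_ii_mult[OF smooth_in_base[OF smooth_in_partial_deriv[OF f]]])
  have rc: "rapid (\<lambda>y. ?c * (?e y * f y))"
    by (rule rapid_mult_growing(1)[OF growing_const r(1)])
  have "(LINT y|lborel. ?g' y) = 0"
  proof (rule integral_directional_derivative_eq_0[where e="axis i 1"])
    fix x :: "real^'n"
    have inn: "(x + s *\<^sub>R axis i 1) \<bullet> \<xi> = x \<bullet> \<xi> + s * \<xi> $ i" for s
      by (simp add: inner_add_left inner_axis')
    have "((\<lambda>z. exp (- (2 * pi * \<i>) * (complex_of_real (x \<bullet> \<xi>) + z * complex_of_real (\<xi> $ i))))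
        has_field_derivative (?c * ?e x)) (at (of_real 0))"
      by (auto intro!: derivative_eq_intros)
    from has_vector_derivative_real_field[OF this]
    have e: "((\<lambda>s. ?e (x + s *\<^sub>R axis i 1)) has_vector_derivative (?c * ?e x)) (at 0)"
      by (simp add: inn)
    have "((\<lambda>s. ?e (x + s *\<^sub>R axis i 1) * f (x + s *\<^sub>R axis i 1)) has_vector_derivative
        (?e (x + 0 *\<^sub>R axis i 1) * partial_deriv i f x + ?c * ?e x * f (x + 0 *\<^sub>R axis i 1))) (at 0)"
      by (intro has_vector_derivative_mult e has_vector_derivative_partial_deriv smooth_in_differentiable[OF f])
    then show "((\<lambda>s. ?g (x + s *\<^sub>R axis i 1)) has_vector_derivative ?g' x) (at 0)"
      by (simp add: mult.assoc)
  qed (intro rapid_add r rc)+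
  also have "(LINT y|lborel. ?g' y) = fourier (partial_deriv i f) \<xi> + ?c * fourier f \<xi>"
    unfolding fourier_def
    using rapid_integrable[OF r(1)] rapid_integrable[OF r(2)] by (subst Bochner_Integration.integral_add) auto
  finally show ?thesis by (simp add: algebra_simps)
qed

lemma borel_measurable_fourier:
  assumes [measurable]: "f \<in> borel_measurable borel"
  shows "fourier f \<in> borel_measurable borel"
  unfolding fourier_def[abs_def] by measurable

lemma smooth_in_rapid_add:
  "smooth_in rapid f \<Longrightarrow> smooth_in rapid g \<Longrightarrow> smooth_in rapid (\<lambda>x. f x + g x)"
  by (rule smooth_in_add) (auto intro: rapid_add)

lemma smooth_in_rapid_cmult:
  fixes f :: "real ^ 'n::finite \<Rightarrow> complex"
  shows "smooth_in rapid f \<Longrightarrow> smooth_in rapid (\<lambda>x. c * f x)"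
  by (rule smooth_in_rapid_linear[OF bounded_linear_mult_right])

text \<open>Apply \<open>1 - \<partial>\<^sub>i\<^sup>2\<close> successively for each
  \<open>i\<close> in \<open>I\<close>. With \<open>I = UNIV\<close>, the transform of
  \<open>f\<close> becomes a bounded function divided by an explicit product, whose reciprocal is
  integrable.\<close>

lemma fourier_mult_polynomial:
  fixes f :: "real ^ 'n::finite \<Rightarrow> complex"
  assumes "smooth_in rapid f" "finite I"
  shows "\<exists>g. smooth_in rapid g \<and> (\<forall>\<xi>. fourier g \<xi> = (\<Prod>i\<in>I. complex_of_real (1 + (2 * pi * \<xi> $ i)\<^sup>2)) * fourier f \<xi>)"
  using assms(2)
proof (induction I)
  case empty
  then show ?case using assms(1) by auto
next
  case (insert i I)
  then obtain g where g: "smooth_in rapid g"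
    and eq: "\<And>\<xi>. fourier g \<xi> = (\<Prod>i\<in>I. complex_of_real (1 + (2 * pi * \<xi> $ i)\<^sup>2)) * fourier f \<xi>"
    by blast
  let ?d = "partial_deriv i (partial_deriv i g)"
  have d: "smooth_in rapid ?d" by (intro smooth_in_partial_deriv g)
  have "fourier (\<lambda>x. g x + (- 1) * ?d x) \<xi> = complex_of_real (1 + (2 * pi * \<xi> $ i)\<^sup>2) * fourier g \<xi>" for \<xi>
    using fourier_partial_deriv[OF g] fourier_partial_deriv[OF smooth_in_partial_deriv[OF g]]
    by (subst fourier_add) (auto intro: smooth_in_base g smooth_in_rapid_cmult[OF d, of "- 1", simplified]
        simp: fourier_cmult[of "- 1", simplified] power2_eq_square algebra_simps)
  moreover have "smooth_in rapid (\<lambda>x. g x + (- 1) * ?d x)"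
    by (intro smooth_in_rapid_add smooth_in_rapid_cmult d g)
  ultimately show ?case
    using insert by (intro exI[of _ "\<lambda>x. g x + (- 1) * ?d x"]) (simp add: eq mult.assoc)
qed

lemma fourier_integrable:
  fixes f :: "real ^ 'n::finite \<Rightarrow> complex"
  assumes f: "smooth_in rapid f"
  shows "integrable lborel (fourier f)"
proof -
  obtain g where g: "smooth_in rapid g"
    and eq: "\<And>\<xi>. fourier g \<xi> = (\<Prod>i\<in>UNIV. complex_of_real (1 + (2 * pi * \<xi> $ i)\<^sup>2)) * fourier f \<xi>"
    using fourier_mult_polynomial[OF f, of UNIV] by auto
  let ?w = "\<lambda>x::real^'n. \<Prod>i\<in>UNIV. inverse (1 + (x $ i)\<^sup>2)"
  define C where "C = (LINT y|lborel. norm (g y))"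
  have w: "integrable lborel ?w"
    by (rule integrable_prod_coordinates)
      (use integrable_inverse_1_plus_square in \<open>simp add: set_integrable_def\<close>)
  show ?thesis
  proof (rule Bochner_Integration.integrable_bound)
    show "integrable lborel (\<lambda>x. C * ?w x)"
      using w by simp
    show "fourier f \<in> borel_measurable lborel"
      using borel_measurable_fourier[of f] rapid_cont[OF smooth_in_base[OF f]]
      by (simp add: borel_measurable_continuous_onI)
    show "AE \<xi> in lborel. norm (fourier f \<xi>) \<le> norm (C * ?w \<xi>)"
    proof (rule AE_I2)
      fix \<xi> :: "real^'n"
      \<comment> \<open>Since \<open>2 * pi \<ge> 1\<close>, the factors may be replaced by those of
        the majorant used for rapidly decaying functions.\<close>
      have "(\<Prod>i\<in>UNIV. 1 + (\<xi> $ i)\<^sup>2) \<le> (\<Prod>i\<in>UNIV. 1 + (2 * pi * \<xi> $ i)\<^sup>2)"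
      proof (rule prod_mono, safe)
        fix i
        have "1 \<le> 2 * pi" using pi_ge_two by simp
        then have "1 * (\<xi> $ i)\<^sup>2 \<le> (2 * pi)\<^sup>2 * (\<xi> $ i)\<^sup>2"
          by (intro mult_right_mono one_le_power) auto
        then show "1 + (\<xi> $ i)\<^sup>2 \<le> 1 + (2 * pi * \<xi> $ i)\<^sup>2"
          by (simp add: power_mult_distrib)
      qed (simp add: add_nonneg_nonneg)
      then have "(\<Prod>i\<in>UNIV. 1 + (\<xi> $ i)\<^sup>2) * norm (fourier f \<xi>) \<le> norm (fourier g \<xi>)"
        unfolding eq norm_mult
        by (intro mult_right_mono) (auto simp: prod_norm[symmetric] abs_of_nonneg simp del: of_real_add of_real_mult of_real_power)
      also have "\<dots> \<le> C" unfolding C_def by (rule norm_fourier_le)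
      finally have 1: "(\<Prod>i\<in>UNIV. 1 + (\<xi> $ i)\<^sup>2) * norm (fourier f \<xi>) \<le> C" .
      have pos: "(\<Prod>i\<in>UNIV. 1 + (\<xi> $ i)\<^sup>2) > 0"
        by (intro prod_pos) (auto intro: add_pos_nonneg)
      from 1 pos have "norm (fourier f \<xi>) \<le> C / (\<Prod>i\<in>UNIV. 1 + (\<xi> $ i)\<^sup>2)"
        by (simp add: field_simps)
      also have "\<dots> = C * ?w \<xi>"
        by (simp add: prod_dividef divide_inverse flip: prod_inversef)
      finally show "norm (fourier f \<xi>) \<le> norm (C * ?w \<xi>)"
        by simp
    qed
  qed
qed

text \<open>The substitution \<open>x = 2 * pi * \<sigma> * t\<close> turns this into the
  characteristic function of the standard normal distribution at \<open>s / \<sigma>\<close>, which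
  is again Gaussian.\<close>

lemma
  assumes \<sigma>: "\<sigma> > 0"
  shows integrable_gaussian_exp_ii:
      "integrable lborel (\<lambda>t. exp (2 * pi * \<i> * complex_of_real (s * t)) * complex_of_real (exp (- (2 * pi * \<sigma> * t)\<^sup>2 / 2)))" (is "integrable _ ?f")
    and integral_gaussian_exp_ii:
      "(LINT t|lborel. exp (2 * pi * \<i> * complex_of_real (s * t)) * complex_of_real (exp (- (2 * pi * \<sigma> * t)\<^sup>2 / 2)))
       = complex_of_real (normal_density 0 \<sigma> s)"
proof -
  let ?h = "\<lambda>x. std_normal_density x *\<^sub>R iexp (s / \<sigma> * x)"
  have ih: "integrable lborel ?h"
    by (rule Bochner_Integration.integrable_bound[OF integrable_normal_density[of 1 0]])
      (auto simp: norm_exp_eq_Re)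
  have "complex_of_real (exp (- ((s / \<sigma>)\<^sup>2) / 2)) = char std_normal_distribution (s / \<sigma>)"
    by (simp only: char_std_normal_distribution)
  also have "\<dots> = (LINT x|lborel. ?h x)"
    unfolding char_def by (subst integral_density) (auto simp: normal_density_nonneg)
  also have "\<dots> = \<bar>2 * pi * \<sigma>\<bar> *\<^sub>R (LINT t|lborel. ?h (0 + (2 * pi * \<sigma>) * t))"
    using \<sigma> by (intro lborel_integral_real_affine) auto
  also have "(\<lambda>t. ?h (0 + (2 * pi * \<sigma>) * t)) = (\<lambda>t. complex_of_real (1 / sqrt (2 * pi)) * ?f t)"
    using \<sigma> by (auto simp: std_normal_density_def scaleR_conv_of_real fun_eq_iff mult_ac)
  finally have eq: "complex_of_real (exp (- ((s / \<sigma>)\<^sup>2) / 2)) =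
      \<bar>2 * pi * \<sigma>\<bar> *\<^sub>R (complex_of_real (1 / sqrt (2 * pi)) * (LINT t|lborel. ?f t))"
    by simp
  have "integrable lborel (\<lambda>t. ?h (0 + (2 * pi * \<sigma>) * t))"
    using \<sigma> ih by (intro lborel_integrable_real_affine) auto
  also have "(\<lambda>t. ?h (0 + (2 * pi * \<sigma>) * t)) = (\<lambda>t. complex_of_real (1 / sqrt (2 * pi)) * ?f t)"
    using \<sigma> by (auto simp: std_normal_density_def scaleR_conv_of_real fun_eq_iff mult_ac)
  finally have "integrable lborel (\<lambda>t. complex_of_real (sqrt (2 * pi)) * (complex_of_real (1 / sqrt (2 * pi)) * ?f t))"
    by (rule integrable_mult_right)
  then show "integrable lborel ?f"
    by (simp flip: mult.assoc of_real_mult)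
  have "normal_density 0 \<sigma> s = exp (- ((s / \<sigma>)\<^sup>2) / 2) / (sqrt (2 * pi) * \<sigma>)"
    using \<sigma> by (simp add: normal_density_def real_sqrt_mult power_divide field_simps)
  also have "\<dots> = exp (- ((s / \<sigma>)\<^sup>2) / 2) * sqrt (2 * pi) / (2 * pi * \<sigma>)"
    using \<sigma> by (simp add: field_simps)
  finally have nd: "normal_density 0 \<sigma> s = exp (- ((s / \<sigma>)\<^sup>2) / 2) * sqrt (2 * pi) / (2 * pi * \<sigma>)" .
  show "(LINT t|lborel. ?f t) = complex_of_real (normal_density 0 \<sigma> s)"
    unfolding nd of_real_mult of_real_divide eq using \<sigma>
    by (simp add: scaleR_conv_of_real field_simps)
qed

text \<open>A convergence factor that tends to 1 as \<open>\<sigma>\<close> tends to 0; its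
  transform is the density of independent centred normal variables with standard deviation
  \<open>\<sigma>\<close>, an approximate identity.\<close>

definition gaussian_damping :: "real \<Rightarrow> real ^ 'n::finite \<Rightarrow> complex" where
  "gaussian_damping \<sigma> \<xi> = (\<Prod>i\<in>UNIV. complex_of_real (exp (- (2 * pi * \<sigma> * \<xi> $ i)\<^sup>2 / 2)))"

lemma norm_gaussian_damping_le_1: "norm (gaussian_damping \<sigma> \<xi>) \<le> 1"
  unfolding gaussian_damping_def prod_norm[symmetric]
  by (rule prod_le_1) (auto simp del: of_real_exp)

lemma borel_measurable_gaussian_damping[measurable]: "gaussian_damping \<sigma> \<in> borel_measurable borel"
  unfolding gaussian_damping_def[abs_def] by measurable

lemma
  fixes w :: "real ^ 'n::finite"
  assumes \<sigma>: "\<sigma> > 0"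
  shows integrable_gaussian_damping_exp_ii:
      "integrable lborel (\<lambda>\<xi>. exp (2 * pi * \<i> * complex_of_real (w \<bullet> \<xi>)) * gaussian_damping \<sigma> \<xi>)" (is ?I)
    and integral_gaussian_damping_exp_ii:
      "(LINT \<xi>|lborel. exp (2 * pi * \<i> * complex_of_real (w \<bullet> \<xi>)) * gaussian_damping \<sigma> \<xi>)
       = (\<Prod>i\<in>UNIV. complex_of_real (normal_density 0 \<sigma> (w $ i)))" (is ?E)
proof -
  let ?f = "\<lambda>i t. exp (2 * pi * \<i> * complex_of_real (w $ i * t)) * complex_of_real (exp (- (2 * pi * \<sigma> * t)\<^sup>2 / 2))"
  have eq: "exp (2 * pi * \<i> * complex_of_real (w \<bullet> \<xi>)) * gaussian_damping \<sigma> \<xi> = (\<Prod>i\<in>UNIV. ?f i (\<xi> $ i))" for \<xi>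
    unfolding gaussian_damping_def prod.distrib
    by (simp only: inner_vec_def of_real_sum sum_distrib_left exp_sum[OF finite] inner_real_def)
  show ?I unfolding eq
    by (intro integrable_prod_coordinates integrable_gaussian_exp_ii \<sigma>)
  show ?E unfolding eq
    by (subst integral_prod_coordinates[OF integrable_gaussian_exp_ii[OF \<sigma>]])
      (simp only: integral_gaussian_exp_ii[OF \<sigma>])
qed

text \<open>Without damping the double integral over \<open>\<xi>\<close> and \<open>y\<close> is
  not absolutely convergent. With the Gaussian factor Fubini applies and gives a Gaussian average of
  \<open>f\<close> around \<open>x\<close>. As \<open>\<sigma>\<close> tends to 0, dominated
  convergence applies on both sides: the transform is integrable, and \<open>f\<close> is bounded
  and continuous.\<close>

lemma fourier_inversion:
  fixes f :: "real ^ 'n::finite \<Rightarrow> complex"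
  assumes f: "rapid f" and i: "integrable lborel (fourier f)"
  shows "(LINT \<xi>|lborel. exp (2 * pi * \<i> * complex_of_real (x \<bullet> \<xi>)) * fourier f \<xi>) = f x"
proof -
  let ?e = "\<lambda>x \<xi>. exp (2 * pi * \<i> * complex_of_real (x \<bullet> \<xi>))"
  have fi: "integrable lborel f" by (rule rapid_integrable[OF f])
  have fc: "continuous_on UNIV f" by (rule rapid_cont[OF f])
  have [measurable]: "f \<in> borel_measurable borel"
    using fc by (rule borel_measurable_continuous_onI)
  have [measurable]: "fourier f \<in> borel_measurable borel"
    by (rule borel_measurable_fourier) measurable
  obtain B where B: "\<And>x. norm (f x) \<le> B"
    using rapidE[OF f, of 0] by (metis mult.right_neutral power_0)
  define N where "N v = (\<Prod>i\<in>UNIV. std_normal_density (v $ i))" for v :: "real^'n"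
  have N: "integrable lborel N" "(LINT v|lborel. N v) = 1"
    unfolding N_def[abs_def]
    by (rule integrable_prod_coordinates, simp) (subst integral_prod_coordinates, simp_all)
  have [measurable]: "N \<in> borel_measurable borel"
    using N(1) by simp
  have N0: "N v \<ge> 0" for v
    unfolding N_def by (intro prod_nonneg) auto
  have A: "(LINT \<xi>|lborel. gaussian_damping \<sigma> \<xi> * (?e x \<xi> * fourier f \<xi>)) =
      (LINT v|lborel. N v *\<^sub>R f (x + \<sigma> *\<^sub>R v))" if \<sigma>: "\<sigma> > 0" for \<sigma>
  proof -
    let ?F = "\<lambda>\<xi> y. (?e (x - y) \<xi> * gaussian_damping \<sigma> \<xi>) * f y"
    have ee: "?e (x - y) \<xi> = ?e x \<xi> * exp (- (2 * pi * \<i>) * complex_of_real (y \<bullet> \<xi>))" for y \<xi>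
      by (simp add: inner_diff_left exp_add[symmetric] algebra_simps)
    have g0: "integrable lborel (gaussian_damping \<sigma> :: real^'n \<Rightarrow> _)"
      using integrable_gaussian_damping_exp_ii[OF \<sigma>, of 0] by simp
    have int: "integrable (lborel \<Otimes>\<^sub>M lborel) (\<lambda>(\<xi>, y). ?F \<xi> y)"
    proof (rule lborel_pair.Fubini_integrable)
      show "(\<lambda>(\<xi>, y). ?F \<xi> y) \<in> borel_measurable (lborel \<Otimes>\<^sub>M lborel)"
        by measurable
      have "(\<lambda>\<xi>. LINT y|lborel. norm (case (\<xi>, y) of (\<xi>, y) \<Rightarrow> ?F \<xi> y)) =
          (\<lambda>\<xi>. norm (gaussian_damping \<sigma> \<xi>) * (LINT y|lborel. norm (f y)))"
        by (simp add: norm_mult norm_exp_eq_Re)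
      then show "integrable lborel (\<lambda>\<xi>. LINT y|lborel. norm (case (\<xi>, y) of (\<xi>, y) \<Rightarrow> ?F \<xi> y))"
        using g0 by simp
      have "integrable lborel (\<lambda>y. ?F \<xi> y)" for \<xi>
        by (rule Bochner_Integration.integrable_bound[OF integrable_norm[OF fi]])
          (auto simp: norm_mult norm_exp_eq_Re norm_gaussian_damping_le_1 mult_left_le_one_le)
      then show "AE \<xi> in lborel. integrable lborel (\<lambda>y. case (\<xi>, y) of (\<xi>, y) \<Rightarrow> ?F \<xi> y)"
        by simp
    qed
    have "gaussian_damping \<sigma> \<xi> * (?e x \<xi> * fourier f \<xi>) = (LINT y|lborel. ?F \<xi> y)" for \<xi>
      unfolding ee fourier_def by (simp flip: integral_mult_right_zero add: mult_ac)
    then have "(LINT \<xi>|lborel. gaussian_damping \<sigma> \<xi> * (?e x \<xi> * fourier f \<xi>)) = (LINT \<xi>|lborel. LINT y|lborel. ?F \<xi> y)"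
      by simp
    also have "\<dots> = (LINT y|lborel. LINT \<xi>|lborel. ?F \<xi> y)"
      by (rule lborel_pair.Fubini_integral[OF int, symmetric])
    also have "\<dots> = (LINT y|lborel. (\<Prod>i\<in>UNIV. complex_of_real (normal_density 0 \<sigma> ((x - y) $ i))) * f y)"
      by (simp only: integral_mult_left_zero integral_gaussian_damping_exp_ii[OF \<sigma>])
    \<comment> \<open>Substitute \<open>y = x + \<sigma> v\<close>: the normal density of width
      \<open>\<sigma>\<close> then becomes the standard one, independent of \<open>\<sigma>\<close>,
      and all dependence on \<open>\<sigma>\<close> moves into the argument of
      \<open>f\<close>.\<close>
    also have "\<dots> = (LINT y|density (distr lborel borel (\<lambda>v. x + \<sigma> *\<^sub>R v)) (\<lambda>_. ennreal (\<bar>\<sigma>\<bar> ^ DIM(real^'n))). (\<Prod>i\<in>UNIV. complex_of_real (normal_density 0 \<sigma> ((x - y) $ i))) * f y)"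
      using \<sigma> lborel_affine[of \<sigma> x] by simp
    also have "\<dots> = (LINT v|lborel. \<sigma> ^ CARD('n) *\<^sub>R ((\<Prod>i\<in>UNIV. complex_of_real (normal_density 0 \<sigma> (- (\<sigma> * v $ i)))) * f (x + \<sigma> *\<^sub>R v)))"
      using \<sigma> by (subst integral_density) (auto simp: integral_distr)
    also have "\<dots> = (LINT v|lborel. N v *\<^sub>R f (x + \<sigma> *\<^sub>R v))"
    proof (rule Bochner_Integration.integral_cong[OF refl])
      fix v :: "real^'n"
      have "normal_density 0 \<sigma> (- (\<sigma> * t)) = std_normal_density t / \<sigma>" for t
        using \<sigma> by (simp add: normal_density_def real_sqrt_mult power_mult_distrib field_simps)
      then have "\<sigma> ^ CARD('n) * (\<Prod>i\<in>UNIV. normal_density 0 \<sigma> (- (\<sigma> * v $ i))) = N v"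
        using \<sigma> by (simp add: N_def prod_dividef)
      then show "\<sigma> ^ CARD('n) *\<^sub>R ((\<Prod>i\<in>UNIV. complex_of_real (normal_density 0 \<sigma> (- (\<sigma> * v $ i)))) * f (x + \<sigma> *\<^sub>R v)) = N v *\<^sub>R f (x + \<sigma> *\<^sub>R v)"
        by (simp add: scaleR_conv_of_real mult.assoc[symmetric] flip: of_real_prod of_real_power of_real_mult)
    qed
    finally show ?thesis .
  qed
  let ?s = "\<lambda>k. 1 / real (Suc k)"
  have s0: "?s \<longlonglongrightarrow> 0" by (rule LIMSEQ_Suc[OF lim_1_over_n])
  have "(\<lambda>k. LINT \<xi>|lborel. gaussian_damping (?s k) \<xi> * (?e x \<xi> * fourier f \<xi>)) \<longlonglongrightarrow> (LINT \<xi>|lborel. ?e x \<xi> * fourier f \<xi>)"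
  proof (rule integral_dominated_convergence[where w="\<lambda>\<xi>. norm (fourier f \<xi>)"])
    show "AE \<xi> in lborel. (\<lambda>k. gaussian_damping (?s k) \<xi> * (?e x \<xi> * fourier f \<xi>)) \<longlonglongrightarrow> ?e x \<xi> * fourier f \<xi>"
    proof (rule AE_I2)
      fix \<xi> :: "real^'n"
      have "(\<lambda>k. gaussian_damping (?s k) \<xi> * (?e x \<xi> * fourier f \<xi>)) \<longlonglongrightarrow>
          (\<Prod>i\<in>(UNIV::'n set). complex_of_real (exp (- (2 * pi * 0 * \<xi> $ i)\<^sup>2 / 2))) * (?e x \<xi> * fourier f \<xi>)"
        unfolding gaussian_damping_def by (intro tendsto_intros s0) auto
      then show "(\<lambda>k. gaussian_damping (?s k) \<xi> * (?e x \<xi> * fourier f \<xi>)) \<longlonglongrightarrow> ?e x \<xi> * fourier f \<xi>"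
        by simp
    qed
    show "AE \<xi> in lborel. norm (gaussian_damping (?s k) \<xi> * (?e x \<xi> * fourier f \<xi>)) \<le> norm (fourier f \<xi>)" for k
    proof (rule AE_I2)
      fix \<xi> :: "real^'n"
      have "norm (?e x \<xi> * fourier f \<xi>) = norm (fourier f \<xi>)"
        by (simp add: norm_mult norm_exp_eq_Re)
      then show "norm (gaussian_damping (?s k) \<xi> * (?e x \<xi> * fourier f \<xi>)) \<le> norm (fourier f \<xi>)"
        unfolding norm_mult[of "gaussian_damping _ _"]
        by (metis mult_left_le_one_le norm_gaussian_damping_le_1 norm_ge_zero)
    qed
    show "integrable lborel (\<lambda>\<xi>. norm (fourier f \<xi>))" using i by simp
  qed measurable
  moreover have "(\<lambda>k. LINT v|lborel. N v *\<^sub>R f (x + ?s k *\<^sub>R v)) \<longlonglongrightarrow> (LINT v|lborel. N v *\<^sub>R f x)"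
  proof (rule integral_dominated_convergence[where w="\<lambda>v. B * N v"])
    show "AE v in lborel. (\<lambda>k. N v *\<^sub>R f (x + ?s k *\<^sub>R v)) \<longlonglongrightarrow> N v *\<^sub>R f x"
    proof (rule AE_I2)
      fix v :: "real^'n"
      have "(\<lambda>k. x + ?s k *\<^sub>R v) \<longlonglongrightarrow> x + 0 *\<^sub>R v"
        by (intro tendsto_intros s0)
      then have "(\<lambda>k. f (x + ?s k *\<^sub>R v)) \<longlonglongrightarrow> f x"
        using fc by (intro isCont_tendsto_compose[where g=f]) (auto simp: continuous_on_eq_continuous_at)
      then show "(\<lambda>k. N v *\<^sub>R f (x + ?s k *\<^sub>R v)) \<longlonglongrightarrow> N v *\<^sub>R f x"
        by (intro tendsto_intros)
    qed
    show "AE v in lborel. norm (N v *\<^sub>R f (x + ?s k *\<^sub>R v)) \<le> B * N v" for k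
      using N0 B by (auto simp: mult.commute[of B] mult_left_mono)
    show "integrable lborel (\<lambda>v. B * N v)" using N by simp
  qed measurable
  ultimately have "(LINT \<xi>|lborel. ?e x \<xi> * fourier f \<xi>) = (LINT v|lborel. N v *\<^sub>R f x)"
    using A[of "?s _"] by (simp add: LIMSEQ_unique)
  also have "\<dots> = f x" using N by simp
  finally show ?thesis .
qed

subsection \<open>The Weyl quantization of a Schroedinger symbol\<close>

lemma smooth_in_rapid_sum:
  fixes f :: "'i \<Rightarrow> real ^ 'n::finite \<Rightarrow> complex"
  assumes "finite I" "\<And>i. i \<in> I \<Longrightarrow> smooth_in rapid (f i)" "I \<noteq> {}"
  shows "smooth_in rapid (\<lambda>x. \<Sum>i\<in>I. f i x)"
  using assms(1,3,2) by (induction I rule: finite_ne_induct) (auto intro: smooth_in_rapid_add)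

lemma fourier_sum:
  fixes f :: "'i \<Rightarrow> real ^ 'n::finite \<Rightarrow> complex"
  assumes "finite I" "\<And>i. i \<in> I \<Longrightarrow> rapid (f i)"
  shows "fourier (\<lambda>x. \<Sum>i\<in>I. f i x) \<xi> = (\<Sum>i\<in>I. fourier (f i) \<xi>)"
  using assms
proof (induction I rule: finite_induct)
  case empty
  then show ?case by (simp add: fourier_def)
next
  case (insert i I)
  then show ?case by (simp add: fourier_add rapid_sum)
qed

text \<open>Fix \<open>x\<close>. Up to the phase at \<open>x\<close>, the inner integral is the
  Fourier transform in \<open>y\<close> of \<open>?\<psi>\<close>, the semiclassical Laplacian of
  \<open>u\<close> plus the potential at \<open>midpoint x y\<close> times \<open>u y\<close>.
  Inversion evaluates \<open>?\<psi>\<close> at \<open>y = x\<close>, where the midpoint is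
  \<open>x\<close> itself, and so the ordinary Schroedinger operator appears.\<close>

lemma weyl_quantization_schroedinger:
  fixes u V :: "real ^ 'n::finite \<Rightarrow> complex"
  assumes V: "smooth_in growing V" and u: "smooth_in rapid u"
    and p: "\<And>x \<xi>. p x \<xi> = complex_of_real ((norm \<xi>)\<^sup>2) + V x"
  shows "weyl_quantization h p u x =
    - complex_of_real ((h / (2 * pi))\<^sup>2) * (\<Sum>i\<in>UNIV. partial_deriv i (partial_deriv i u) x) + V x * u x"
proof -
  let ?c = "- complex_of_real ((h / (2 * pi))\<^sup>2)"
  let ?D = "\<lambda>i. partial_deriv i (partial_deriv i u)"
  let ?g = "\<lambda>y. V (midpoint x y) * u y"
  let ?\<psi> = "\<lambda>y. ?c * (\<Sum>i\<in>UNIV. ?D i y) + ?g y"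
  have D: "smooth_in rapid (?D i)" for i
    by (intro smooth_in_partial_deriv u)
  have S: "smooth_in rapid (\<lambda>y. \<Sum>i\<in>UNIV. ?D i y)"
    by (rule smooth_in_rapid_sum) (auto intro: D)
  have cS: "smooth_in rapid (\<lambda>y. ?c * (\<Sum>i\<in>UNIV. ?D i y))"
    by (rule smooth_in_rapid_cmult[OF S])
  have g: "smooth_in rapid ?g"
    by (rule smooth_in_mult[where Q=growing, OF rapid_mult_growing(1) rapid_add smooth_in_growing_midpoint[OF V] u])
  have \<psi>: "smooth_in rapid ?\<psi>"
    by (rule smooth_in_rapid_add[OF cS g])
  have f\<psi>: "fourier ?\<psi> \<xi> = complex_of_real ((norm (h *\<^sub>R \<xi>))\<^sup>2) * fourier u \<xi> + fourier ?g \<xi>" for \<xi>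
  proof -
    have n: "(norm \<xi>)\<^sup>2 = (\<Sum>i\<in>UNIV. (\<xi> $ i)\<^sup>2)"
      unfolding power2_norm_eq_inner inner_vec_def by (simp add: power2_eq_square)
    have "fourier ?\<psi> \<xi> = ?c * (\<Sum>i\<in>UNIV. fourier (?D i) \<xi>) + fourier ?g \<xi>"
      by (simp only: fourier_add[OF smooth_in_base[OF cS] smooth_in_base[OF g]] fourier_cmult
          fourier_sum[OF finite smooth_in_base[OF D]])
    also have "(\<Sum>i\<in>UNIV. fourier (?D i) \<xi>) = (\<Sum>i\<in>UNIV. - complex_of_real ((2 * pi)\<^sup>2) * complex_of_real ((\<xi> $ i)\<^sup>2) * fourier u \<xi>)"
      by (simp add: fourier_partial_deriv[OF smooth_in_partial_deriv[OF u]] fourier_partial_deriv[OF u]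
          power2_eq_square algebra_simps)
    also have "\<dots> = - complex_of_real ((2 * pi)\<^sup>2) * complex_of_real ((norm \<xi>)\<^sup>2) * fourier u \<xi>"
      unfolding n of_real_sum sum_distrib_left sum_distrib_right ..
    finally show ?thesis
      by (simp add: power_mult_distrib power_divide field_simps)
  qed
  have inner: "(LINT y|lborel. exp (2 * complex_of_real pi * \<i> * complex_of_real ((x - y) \<bullet> \<xi>)) *
        p (midpoint x y) (h *\<^sub>R \<xi>) * u y) =
      exp (2 * pi * \<i> * complex_of_real (x \<bullet> \<xi>)) * fourier ?\<psi> \<xi>" for \<xi>
  proof -
    let ?e = "\<lambda>y. exp (- (2 * pi * \<i>) * complex_of_real (y \<bullet> \<xi>))"
    have ee: "exp (2 * complex_of_real pi * \<i> * complex_of_real ((x - y) \<bullet> \<xi>)) =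
        exp (2 * pi * \<i> * complex_of_real (x \<bullet> \<xi>)) * ?e y" for y
      by (simp add: inner_diff_left exp_add[symmetric] algebra_simps)
    have "(LINT y|lborel. exp (2 * complex_of_real pi * \<i> * complex_of_real ((x - y) \<bullet> \<xi>)) *
        p (midpoint x y) (h *\<^sub>R \<xi>) * u y) =
      (LINT y|lborel. exp (2 * pi * \<i> * complex_of_real (x \<bullet> \<xi>)) *
        (complex_of_real ((norm (h *\<^sub>R \<xi>))\<^sup>2) * (?e y * u y) + ?e y * ?g y))"
      unfolding ee p by (intro Bochner_Integration.integral_cong refl) (simp only: algebra_simps)
    also have "\<dots> = exp (2 * pi * \<i> * complex_of_real (x \<bullet> \<xi>)) *
        (complex_of_real ((norm (h *\<^sub>R \<xi>))\<^sup>2) * fourier u \<xi> + fourier ?g \<xi>)"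
      unfolding integral_mult_right_zero fourier_def
      by (subst Bochner_Integration.integral_add)
        (use rapid_integrable[OF rapid_exp_ii_mult[OF smooth_in_base[OF u]]]
          rapid_integrable[OF rapid_exp_ii_mult[OF smooth_in_base[OF g]]] in auto)
    finally show ?thesis unfolding f\<psi> .
  qed
  have "weyl_quantization h p u x = (LINT \<xi>|lborel. exp (2 * pi * \<i> * complex_of_real (x \<bullet> \<xi>)) * fourier ?\<psi> \<xi>)"
    unfolding weyl_quantization_def inner ..
  also have "\<dots> = ?\<psi> x"
    by (rule fourier_inversion[OF smooth_in_base[OF \<psi>] fourier_integrable[OF \<psi>]])
  finally show ?thesis by simp
qed

section \<open>Integration by parts and the Cauchy-Schwarz inequality\<close>

lemma rapid_cnj:
  assumes "rapid f"
  shows "rapid (\<lambda>x. cnj (f x))"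
  by (rule rapid_le[where c=1, OF assms]) (auto intro!: continuous_intros rapid_cont[OF assms])

lemma growing_of_real:
  assumes "growing f"
  shows "growing (\<lambda>x. complex_of_real (f x))"
  by (rule growing_le[where c=1, OF assms]) (auto intro!: continuous_intros growing_cont[OF assms])

text \<open>\<open>I\<close> is the product rule for the derivative of \<open>k * cnj u * v\<close>
  in direction \<open>j\<close>, and a derivative of a rapidly decaying function integrates to zero.
  The weight \<open>k\<close> enters through its directional derivative only, so it need not be
  smooth.\<close>

lemma
  fixes u v :: "real ^ 'n::finite \<Rightarrow> complex" and k k' :: "real ^ 'n \<Rightarrow> real"
  assumes u: "smooth_in rapid u" and v: "smooth_in rapid v"
    and k: "growing k" and k': "growing k'"
    and deriv: "\<And>x. ((\<lambda>s. k (x + s *\<^sub>R axis j 1)) has_vector_derivative k' x) (at 0)"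
  defines "I \<equiv> \<lambda>x. complex_of_real (k' x) * (cnj (u x) * v x) +
      complex_of_real (k x) * (cnj (u x) * partial_deriv j v x + cnj (partial_deriv j u x) * v x)"
  shows rapid_integration_by_parts: "rapid I"
    and integration_by_parts: "(LINT x|lborel. I x) = 0"
proof -
  have ru: "rapid u" and rv: "rapid v" and ru': "rapid (partial_deriv j u)" and rv': "rapid (partial_deriv j v)"
    using u v smooth_in_base smooth_in_partial_deriv by blast+
  have cr: "rapid (\<lambda>x. cnj (f x) * g x)" if "rapid f" "rapid g" for f g :: "real ^ 'n \<Rightarrow> complex"
    by (rule rapid_mult_growing(1)[OF rapid_imp_growing[OF rapid_cnj]]) (fact that)+
  have g: "rapid (\<lambda>x. complex_of_real (k x) * (cnj (u x) * v x))"
    by (rule rapid_mult_growing(1)[OF growing_of_real[OF k] cr[OF ru rv]])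
  show I: "rapid I"
    unfolding I_def
    by (rule rapid_add[OF rapid_mult_growing(1)[OF growing_of_real[OF k'] cr[OF ru rv]]
          rapid_mult_growing(1)[OF growing_of_real[OF k] rapid_add[OF cr[OF ru rv'] cr[OF ru' rv]]]])
  show "(LINT x|lborel. I x) = 0"
  proof (rule integral_directional_derivative_eq_0[OF _ g I, where e="axis j 1"])
    fix x
    have du: "((\<lambda>s. u (x + s *\<^sub>R axis j 1)) has_vector_derivative partial_deriv j u x) (at 0)"
      and dv: "((\<lambda>s. v (x + s *\<^sub>R axis j 1)) has_vector_derivative partial_deriv j v x) (at 0)"
      by (intro has_vector_derivative_partial_deriv smooth_in_differentiable[OF u] smooth_in_differentiable[OF v])+
    have dc: "((\<lambda>s. cnj (u (x + s *\<^sub>R axis j 1))) has_vector_derivative cnj (partial_deriv j u x)) (at 0)"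
      by (rule bounded_linear.has_vector_derivative[OF bounded_linear_cnj du])
    have dk: "((\<lambda>s. complex_of_real (k (x + s *\<^sub>R axis j 1))) has_vector_derivative complex_of_real (k' x)) (at 0)"
      by (rule bounded_linear.has_vector_derivative[OF bounded_linear_of_real deriv])
    show "((\<lambda>s. complex_of_real (k (x + s *\<^sub>R axis j 1)) * (cnj (u (x + s *\<^sub>R axis j 1)) * v (x + s *\<^sub>R axis j 1)))
        has_vector_derivative I x) (at 0)"
      using has_vector_derivative_mult[OF dk has_vector_derivative_mult[OF dc dv]]
      by (simp add: I_def algebra_simps)
  qed
qed

text \<open>The integral of \<open>(t f - g)\<^sup>2\<close> is a nonnegative quadratic polynomial
  in \<open>t\<close>, so its discriminant is not positive.\<close>

lemma integral_mult_le_L2: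
  fixes f g :: "real ^ 'n::finite \<Rightarrow> real"
  assumes f: "rapid f" and g: "rapid g"
  shows "(LINT x|lborel. f x * g x) \<le> sqrt (LINT x|lborel. (f x)\<^sup>2) * sqrt (LINT x|lborel. (g x)\<^sup>2)"
proof -
  define A where "A = (LINT x|lborel. (f x)\<^sup>2)"
  define B where "B = (LINT x|lborel. f x * g x)"
  define C where "C = (LINT x|lborel. (g x)\<^sup>2)"
  have i: "integrable lborel (\<lambda>x. (f x)\<^sup>2)" "integrable lborel (\<lambda>x. (g x)\<^sup>2)" "integrable lborel (\<lambda>x. f x * g x)"
    unfolding power2_eq_square
    by (intro rapid_integrable rapid_mult_growing(1)[OF rapid_imp_growing] f g)+
  have pos: "A \<ge> 0" "C \<ge> 0" unfolding A_def C_def by simp_all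
  have q: "0 \<le> A * t\<^sup>2 - 2 * B * t + C" for t
  proof -
    have "0 \<le> (LINT x|lborel. (t * f x - g x)\<^sup>2)" by simp
    also have "\<dots> = (LINT x|lborel. t\<^sup>2 * (f x)\<^sup>2 - 2 * t * (f x * g x) + (g x)\<^sup>2)"
      by (simp add: power2_eq_square algebra_simps)
    also have "\<dots> = t\<^sup>2 * A - 2 * t * B + C"
      unfolding A_def B_def C_def using i by simp
    finally show ?thesis by (simp add: algebra_simps)
  qed
  have "B\<^sup>2 \<le> A * C"
  proof (cases "A = 0")
    case True
    have "B = 0"
    proof (rule ccontr)
      assume "B \<noteq> 0"
      \<comment> \<open>For \<open>A = 0\<close> the polynomial is affine, and at this
        \<open>t\<close> its value is -1.\<close>
      then show False using q[of "(C + 1) / (2 * B)"] True pos by simp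
    qed
    then show ?thesis using pos by simp
  next
    case False
    \<comment> \<open>This \<open>t\<close> is the minimizer of the quadratic polynomial.\<close>
    then show ?thesis using q[of "B / A"] pos by (simp add: field_simps power2_eq_square)
  qed
  then have "\<bar>B\<bar> \<le> sqrt (A * C)"
    by (simp add: real_le_rsqrt)
  then show ?thesis
    unfolding A_def B_def C_def real_sqrt_mult by linarith
qed

subsection \<open>Integral identities\<close>

definition grad_norm :: "(real ^ 'n::finite \<Rightarrow> complex) \<Rightarrow> real ^ 'n \<Rightarrow> real" where
  "grad_norm u x = L2_set (\<lambda>j. norm (partial_deriv j u x)) UNIV"

definition laplacian :: "(real ^ 'n::finite \<Rightarrow> complex) \<Rightarrow> real ^ 'n \<Rightarrow> complex" where
  "laplacian u x = (\<Sum>j\<in>UNIV. partial_deriv j (partial_deriv j u) x)"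

lemma rapid_norm:
  assumes "rapid f"
  shows "rapid (\<lambda>x. norm (f x))"
  by (rule rapid_le[where c=1, OF assms]) (auto intro!: continuous_intros rapid_cont[OF assms])

lemma smooth_in_rapid_partial_derivs:
  assumes "smooth_in rapid u"
  shows "rapid u" "rapid (partial_deriv i u)" "rapid (partial_deriv j (partial_deriv i u))"
  using assms smooth_in_partial_deriv smooth_in_base by metis+

lemma rapid_laplacian: "smooth_in rapid u \<Longrightarrow> rapid (laplacian u)"
  unfolding laplacian_def by (intro rapid_sum smooth_in_rapid_partial_derivs)

lemma rapid_grad_norm:
  assumes u: "smooth_in rapid u"
  shows "rapid (grad_norm u)"
proof (rule rapid_le[where c=1])
  have r: "rapid (\<lambda>x. norm (partial_deriv j u x))" for j
    by (rule rapid_norm[OF smooth_in_rapid_partial_derivs(2)[OF u]])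
  show "rapid (\<lambda>x. \<Sum>j\<in>UNIV. norm (partial_deriv j u x))"
    by (intro rapid_sum r)
  show "continuous_on UNIV (grad_norm u)"
    unfolding grad_norm_def[abs_def] L2_set_def by (intro continuous_intros rapid_cont[OF r])
  show "norm (grad_norm u x) \<le> 1 * norm (\<Sum>j\<in>UNIV. norm (partial_deriv j u x))" for x
    using L2_set_le_sum[of UNIV "\<lambda>j. norm (partial_deriv j u x)"]
    by (simp add: grad_norm_def sum_nonneg)
qed

lemma grad_norm_nonneg: "grad_norm u x \<ge> 0"
  by (simp add: grad_norm_def)

lemma rapid_mult:
  fixes f g :: "real ^ 'n::finite \<Rightarrow> 'b::real_normed_algebra"
  shows "rapid f \<Longrightarrow> rapid g \<Longrightarrow> rapid (\<lambda>x. f x * g x)"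
  by (rule rapid_mult_growing(1)[OF rapid_imp_growing])

lemma rapid_power2:
  fixes f :: "real ^ 'n::finite \<Rightarrow> 'b::real_normed_algebra_1"
  shows "rapid f \<Longrightarrow> rapid (\<lambda>x. (f x)\<^sup>2)"
  unfolding power2_eq_square by (rule rapid_mult)

text \<open>The vector field has components \<open>k j * cnj u * v j\<close>. Taking
  \<open>v j\<close> to be the \<open>j\<close>-th derivative of \<open>u\<close> gives the energy
  and flux identities, and \<open>v j = u\<close> gives the density identity.\<close>

lemma divergence_theorem:
  fixes u :: "real ^ 'n::finite \<Rightarrow> complex" and v :: "'n \<Rightarrow> real ^ 'n \<Rightarrow> complex" and k k' :: "'n \<Rightarrow> real ^ 'n \<Rightarrow> real"
  assumes u: "smooth_in rapid u" and v: "\<And>j. smooth_in rapid (v j)"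
    and k: "\<And>j. growing (k j)" and k': "\<And>j. growing (k' j)"
    and deriv: "\<And>j x. ((\<lambda>s. k j (x + s *\<^sub>R axis j 1)) has_vector_derivative k' j x) (at 0)"
  defines "I \<equiv> \<lambda>x. (\<Sum>j\<in>UNIV. complex_of_real (k' j x) * (cnj (u x) * v j x) +
      complex_of_real (k j x) * (cnj (u x) * partial_deriv j (v j) x + cnj (partial_deriv j u x) * v j x))"
  shows "rapid I" "(LINT x|lborel. I x) = 0"
proof -
  let ?I = "\<lambda>j x. complex_of_real (k' j x) * (cnj (u x) * v j x) +
      complex_of_real (k j x) * (cnj (u x) * partial_deriv j (v j) x + cnj (partial_deriv j u x) * v j x)"
  have r: "rapid (?I j)" for j
    by (rule rapid_integration_by_parts[OF u v k k' deriv])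
  have z: "(LINT x|lborel. ?I j x) = 0" for j
    by (rule integration_by_parts[OF u v k k' deriv])
  show "rapid I" unfolding I_def by (intro rapid_sum r)
  show "(LINT x|lborel. I x) = 0"
    unfolding I_def by (subst Bochner_Integration.integral_sum) (auto simp: z intro: rapid_integrable r)
qed

lemma energy_identity:
  fixes u :: "real ^ 'n::finite \<Rightarrow> complex"
  assumes u: "smooth_in rapid u"
  shows "(LINT x|lborel. Re (cnj (u x) * laplacian u x)) = - (LINT x|lborel. (grad_norm u x)\<^sup>2)"
proof -
  let ?I = "\<lambda>x. (\<Sum>j\<in>UNIV. complex_of_real 0 * (cnj (u x) * partial_deriv j u x) +
      complex_of_real 1 * (cnj (u x) * partial_deriv j (partial_deriv j u) x + cnj (partial_deriv j u x) * partial_deriv j u x))"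
  have I: "rapid ?I" "(LINT x|lborel. ?I x) = 0"
    using divergence_theorem[where k="\<lambda>_ _. 1" and k'="\<lambda>_ _. 0" and v="\<lambda>j. partial_deriv j u", OF u smooth_in_partial_deriv[OF u]]
    by (auto simp: growing_const)
  have eq: "Re (?I x) = Re (cnj (u x) * laplacian u x) + (grad_norm u x)\<^sup>2" for x
    by (simp add: laplacian_def grad_norm_def L2_set_def sum_nonneg sum.distrib sum_distrib_left cmod_power2
        power2_eq_square[of "Re _"] power2_eq_square[of "Im _"])
  have l: "rapid (\<lambda>x. Re (cnj (u x) * laplacian u x))"
    by (intro rapid_Re rapid_mult rapid_cnj smooth_in_rapid_partial_derivs(1)[OF u] rapid_laplacian[OF u])
  have "0 = Re (LINT x|lborel. ?I x)" by (simp only: I zero_complex.simps)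
  also have "\<dots> = (LINT x|lborel. Re (?I x))"
    by (rule integral_Re[symmetric]) (rule rapid_integrable[OF I(1)])
  also have "\<dots> = (LINT x|lborel. Re (cnj (u x) * laplacian u x)) + (LINT x|lborel. (grad_norm u x)\<^sup>2)"
    unfolding eq by (intro Bochner_Integration.integral_add rapid_integrable l rapid_power2 rapid_grad_norm u)
  finally show ?thesis by linarith
qed

text \<open>In the imaginary part the terms \<open>k\<close> times the squared modulus of a
  derivative of \<open>u\<close> disappear, so only the current survives and the derivative falls on
  the weight.\<close>

lemma flux_identity:
  fixes u :: "real ^ 'n::finite \<Rightarrow> complex"
  assumes u: "smooth_in rapid u"
    and k: "growing k" and k': "\<And>j. growing (k' j)"
    and deriv: "\<And>j x. ((\<lambda>s. k (x + s *\<^sub>R axis j 1)) has_vector_derivative k' j x) (at 0)"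
  shows "(LINT x|lborel. k x * Im (cnj (u x) * laplacian u x)) =
    - (LINT x|lborel. (\<Sum>j\<in>UNIV. k' j x * Im (cnj (u x) * partial_deriv j u x)))"
proof -
  let ?I = "\<lambda>x. (\<Sum>j\<in>UNIV. complex_of_real (k' j x) * (cnj (u x) * partial_deriv j u x) +
      complex_of_real (k x) * (cnj (u x) * partial_deriv j (partial_deriv j u) x + cnj (partial_deriv j u x) * partial_deriv j u x))"
  have I: "rapid ?I" "(LINT x|lborel. ?I x) = 0"
    using divergence_theorem[where k="\<lambda>_. k" and v="\<lambda>j. partial_deriv j u", OF u smooth_in_partial_deriv[OF u] k k' deriv]
    by auto
  note r = smooth_in_rapid_partial_derivs(1,2)[OF u] rapid_laplacian[OF u]
  have eq: "Im (?I x) = (\<Sum>j\<in>UNIV. k' j x * Im (cnj (u x) * partial_deriv j u x)) + k x * Im (cnj (u x) * laplacian u x)" for x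
    by (simp add: laplacian_def sum.distrib sum_distrib_left sum_subtractf right_diff_distrib distrib_left)
  have l: "rapid (\<lambda>x. k x * Im (cnj (u x) * laplacian u x))"
    by (intro rapid_mult_growing(1)[OF k] rapid_Im rapid_mult rapid_cnj r)
  have f: "rapid (\<lambda>x. \<Sum>j\<in>UNIV. k' j x * Im (cnj (u x) * partial_deriv j u x))"
    by (intro rapid_sum rapid_mult_growing(1)[OF k'] rapid_Im rapid_mult rapid_cnj r)
  have "0 = Im (LINT x|lborel. ?I x)" by (simp only: I zero_complex.simps)
  also have "\<dots> = (LINT x|lborel. Im (?I x))"
    by (rule integral_Im[symmetric]) (rule rapid_integrable[OF I(1)])
  also have "\<dots> = (LINT x|lborel. (\<Sum>j\<in>UNIV. k' j x * Im (cnj (u x) * partial_deriv j u x))) + (LINT x|lborel. k x * Im (cnj (u x) * laplacian u x))"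
    unfolding eq by (intro Bochner_Integration.integral_add rapid_integrable l f)
  finally show ?thesis by linarith
qed

lemma density_identity:
  fixes u :: "real ^ 'n::finite \<Rightarrow> complex"
  assumes u: "smooth_in rapid u"
    and k: "\<And>j. growing (k j)" and k': "\<And>j. growing (k' j)"
    and deriv: "\<And>j x. ((\<lambda>s. k j (x + s *\<^sub>R axis j 1)) has_vector_derivative k' j x) (at 0)"
  shows "(LINT x|lborel. (\<Sum>j\<in>UNIV. k' j x) * (norm (u x))\<^sup>2) =
    - (LINT x|lborel. (\<Sum>j\<in>UNIV. k j x * (2 * Re (cnj (u x) * partial_deriv j u x))))"
proof -
  let ?I = "\<lambda>x. (\<Sum>j\<in>UNIV. complex_of_real (k' j x) * (cnj (u x) * u x) +
      complex_of_real (k j x) * (cnj (u x) * partial_deriv j u x + cnj (partial_deriv j u x) * u x))"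
  have I: "rapid ?I" "(LINT x|lborel. ?I x) = 0"
    using divergence_theorem[where v="\<lambda>j. u", OF u u k k' deriv] by auto
  note r = smooth_in_rapid_partial_derivs(1,2)[OF u]
  have eq: "Re (?I x) = (\<Sum>j\<in>UNIV. k' j x) * (norm (u x))\<^sup>2 + (\<Sum>j\<in>UNIV. k j x * (2 * Re (cnj (u x) * partial_deriv j u x)))" for x
    unfolding sum_distrib_right Re_sum sum.distrib[symmetric]
    by (intro sum.cong refl) (simp add: cmod_power2 power2_eq_square[of "Re _"] power2_eq_square[of "Im _"] algebra_simps)
  have l: "rapid (\<lambda>x. (\<Sum>j\<in>UNIV. k' j x) * (norm (u x))\<^sup>2)"
    by (intro rapid_mult_growing(1)[OF growing_sum[OF k']] rapid_power2 rapid_norm r)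
  have f: "rapid (\<lambda>x. \<Sum>j\<in>UNIV. k j x * (2 * Re (cnj (u x) * partial_deriv j u x)))"
    by (intro rapid_sum rapid_mult_growing(1)[OF k] rapid_mult_growing(1)[OF growing_const] rapid_Re rapid_mult rapid_cnj r)
  have "0 = Re (LINT x|lborel. ?I x)" by (simp only: I zero_complex.simps)
  also have "\<dots> = (LINT x|lborel. Re (?I x))"
    by (rule integral_Re[symmetric]) (rule rapid_integrable[OF I(1)])
  also have "\<dots> = (LINT x|lborel. (\<Sum>j\<in>UNIV. k' j x) * (norm (u x))\<^sup>2) + (LINT x|lborel. (\<Sum>j\<in>UNIV. k j x * (2 * Re (cnj (u x) * partial_deriv j u x))))"
    unfolding eq by (intro Bochner_Integration.integral_add rapid_integrable l f)
  finally show ?thesis by linarith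
qed

text \<open>Cauchy-Schwarz over the coordinates. Leaving \<open>r\<close> abstract covers both the
  real part (density) and the imaginary part (flux) of \<open>cnj u\<close> times a
  derivative.\<close>

lemma sum_mult_partial_deriv_le:
  fixes u :: "real ^ 'n::finite \<Rightarrow> complex" and k :: "'n \<Rightarrow> real"
  assumes "\<And>j. \<bar>r j\<bar> \<le> norm (cnj (u x) * partial_deriv j u x)"
  shows "\<bar>\<Sum>j\<in>UNIV. k j * r j\<bar> \<le> L2_set k UNIV * norm (u x) * grad_norm u x"
proof -
  have "\<bar>\<Sum>j\<in>UNIV. k j * r j\<bar> \<le> (\<Sum>j\<in>UNIV. \<bar>k j * r j\<bar>)"
    by (rule sum_abs)
  also have "\<dots> \<le> (\<Sum>j\<in>UNIV. norm (u x) * (\<bar>k j\<bar> * \<bar>norm (partial_deriv j u x)\<bar>))"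
    using mult_left_mono[OF assms abs_ge_zero]
    by (intro sum_mono) (simp add: abs_mult norm_mult mult_ac)
  also have "\<dots> \<le> norm (u x) * (L2_set k UNIV * grad_norm u x)"
    unfolding sum_distrib_left[symmetric] grad_norm_def
    by (intro mult_left_mono L2_set_mult_ineq) auto
  finally show ?thesis by (simp add: mult_ac)
qed

subsection \<open>Weighted estimates\<close>

lemma L2_norm_power2: "(L2_norm f)\<^sup>2 = (LINT x|lborel. (norm (f x))\<^sup>2)"
  unfolding L2_norm_def by (rule real_sqrt_pow2) simp

lemma L2_norm_nonneg: "L2_norm f \<ge> 0"
  by (simp add: L2_norm_def)

lemma integral_mult_le_L2_norm:
  fixes f g :: "real ^ 'n::finite \<Rightarrow> complex"
  assumes "rapid f" "rapid g"
  shows "(LINT x|lborel. norm (f x) * norm (g x)) \<le> L2_norm f * L2_norm g"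
  unfolding L2_norm_def by (rule integral_mult_le_L2) (intro rapid_norm assms)+

definition grad_L2_norm :: "(real ^ 'n::finite \<Rightarrow> complex) \<Rightarrow> real" where
  "grad_L2_norm u = L2_norm (\<lambda>x. complex_of_real (grad_norm u x))"

text \<open>Pairing with \<open>u\<close> and taking real parts removes \<open>W\<close>, and
  \<open>V\<^sub>1 \<ge> 0\<close> lets its contribution be discarded. No sign of
  \<open>\<rho>\<close> is assumed; this is exploited later to bound \<open>Re z\<close> from
  below.\<close>

lemma energy_inequality:
  fixes u :: "real ^ 'n::finite \<Rightarrow> complex" and V\<^sub>1 W :: "real ^ 'n \<Rightarrow> real" and \<alpha> \<rho> :: real
  assumes u: "smooth_in rapid u" and V1: "growing V\<^sub>1" "\<And>x. V\<^sub>1 x \<ge> 0" and W: "growing W"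
  defines "f \<equiv> \<lambda>x. - complex_of_real (\<alpha>\<^sup>2) * laplacian u x +
    (complex_of_real (V\<^sub>1 x - \<rho>) + \<i> * complex_of_real (W x)) * u x"
  shows "rapid f" "\<alpha>\<^sup>2 * (grad_L2_norm u)\<^sup>2 \<le> L2_norm f * L2_norm u + \<rho> * (L2_norm u)\<^sup>2"
proof -
  note r = smooth_in_rapid_partial_derivs(1,2)[OF u] rapid_laplacian[OF u]
  show rf: "rapid f"
    unfolding f_def
    by (intro rapid_add rapid_mult_growing(1)[OF growing_const] rapid_mult_growing(1)[OF growing_add[OF growing_of_real[OF growing_diff[OF V1(1) growing_const]]
            growing_mult[OF growing_const growing_of_real[OF W]]]] r)
  have i1: "rapid (\<lambda>x. Re (cnj (u x) * laplacian u x))" "rapid (\<lambda>x. V\<^sub>1 x * (norm (u x))\<^sup>2)" "rapid (\<lambda>x. (norm (u x))\<^sup>2)"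
    by (intro rapid_Re rapid_mult rapid_cnj r rapid_mult_growing(1)[OF V1(1)] rapid_power2 rapid_norm)+
  have "Re (cnj (u x) * f x) = - (\<alpha>\<^sup>2) * Re (cnj (u x) * laplacian u x) + V\<^sub>1 x * (norm (u x))\<^sup>2 - \<rho> * (norm (u x))\<^sup>2" for x
    by (simp add: f_def cmod_power2 power2_eq_square[of "Re _"] power2_eq_square[of "Im _"] algebra_simps)
  then have "(LINT x|lborel. Re (cnj (u x) * f x)) =
      - (\<alpha>\<^sup>2) * (LINT x|lborel. Re (cnj (u x) * laplacian u x)) + (LINT x|lborel. V\<^sub>1 x * (norm (u x))\<^sup>2)
      - \<rho> * (LINT x|lborel. (norm (u x))\<^sup>2)"
    using i1[THEN rapid_integrable] by simp
  also have "\<dots> \<ge> \<alpha>\<^sup>2 * (grad_L2_norm u)\<^sup>2 - \<rho> * (L2_norm u)\<^sup>2"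
    unfolding energy_identity[OF u] grad_L2_norm_def L2_norm_power2
    using V1(2) by (simp add: integral_nonneg_AE)
  finally have 1: "\<alpha>\<^sup>2 * (grad_L2_norm u)\<^sup>2 - \<rho> * (L2_norm u)\<^sup>2 \<le> (LINT x|lborel. Re (cnj (u x) * f x))" .
  also have "\<dots> \<le> (LINT x|lborel. norm (f x) * norm (u x))"
  proof (rule integral_mono)
    show "integrable lborel (\<lambda>x. Re (cnj (u x) * f x))" "integrable lborel (\<lambda>x. norm (f x) * norm (u x))"
      by (intro rapid_integrable rapid_Re rapid_mult rapid_cnj rapid_norm r rf)+
    show "Re (cnj (u x) * f x) \<le> norm (f x) * norm (u x)" for x
      using complex_Re_le_cmod[of "cnj (u x) * f x"] by (simp add: norm_mult mult.commute)
  qed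
  also have "\<dots> \<le> L2_norm f * L2_norm u"
    by (rule integral_mult_le_L2_norm[OF rf r(1)])
  finally show "\<alpha>\<^sup>2 * (grad_L2_norm u)\<^sup>2 \<le> L2_norm f * L2_norm u + \<rho> * (L2_norm u)\<^sup>2" by linarith
qed

text \<open>To be instantiated with \<open>W = V\<^sub>2 - Im z\<close> and
  \<open>L = norm z - T\<close>. The bound \<open>C\<close> on second derivatives of
  \<open>W\<close> is what keeps derivatives of the weight under control.\<close>

locale gradient_weight =
  fixes W :: "real ^ 'n::finite \<Rightarrow> real" and L C :: real
  assumes W: "smooth_in growing W"
    and L: "L > 0"
    and bound: "\<And>i j x. \<bar>partial_deriv j (partial_deriv i W) x\<bar> \<le> C"
begin

section \<open>The weight and its derivatives\<close>

definition G :: "real ^ 'n \<Rightarrow> real" where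
  "G x = (\<Sum>i\<in>UNIV. (partial_deriv i W x)\<^sup>2)"

text \<open>Adding \<open>L\<close> keeps the weight bounded where the gradient of \<open>W\<close>
  vanishes, while \<open>G * S \<le> 1\<close> where it is large.\<close>

definition S :: "real ^ 'n \<Rightarrow> real" where
  "S x = inverse (G x + L)"

text \<open>This is the derivative of \<open>G\<close> in direction \<open>j\<close>, as established
  inside \<open>deriv_S\<close>.\<close>

definition G' :: "'n \<Rightarrow> real ^ 'n \<Rightarrow> real" where
  "G' j x = (\<Sum>i\<in>UNIV. 2 * partial_deriv i W x * partial_deriv j (partial_deriv i W) x)"

lemma C_nonneg: "C \<ge> 0"
  using bound[of undefined undefined 0] by linarith

lemma card_ge_1: "real CARD('n) \<ge> 1"
  using one_le_card_finite by (metis One_nat_def of_nat_1 of_nat_le_iff)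

lemma G_nonneg: "G x \<ge> 0"
  unfolding G_def by (intro sum_nonneg) simp

lemma S_pos: "S x > 0"
  unfolding S_def using L G_nonneg[of x] by simp

lemma G_S_le_1: "G x * S x \<le> 1"
  unfolding S_def using L G_nonneg[of x] by (simp add: field_simps)

lemma S_le: "S x \<le> 1 / L"
  unfolding S_def using L G_nonneg[of x] by (simp add: field_simps)

text \<open>A factor \<open>sqrt G\<close>, the length of the gradient of \<open>W\<close>, is paid
  for with half a power of the weight. All later estimates trade powers this way.\<close>

lemma sqrt_G_S: "sqrt (G x) * S x \<le> sqrt (S x)"
proof -
  have "sqrt (G x) * S x = sqrt (G x * S x) * sqrt (S x)"
    using S_pos[of x] by (simp add: real_sqrt_mult)
  also have "\<dots> \<le> 1 * sqrt (S x)"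
    using G_S_le_1[of x] S_pos[of x] by (intro mult_right_mono) auto
  finally show ?thesis by simp
qed

lemma sqrt_S_le: "sqrt (S x) \<le> 1 / sqrt L"
  using S_le[of x] by (metis real_sqrt_divide real_sqrt_le_iff real_sqrt_one)

lemma partial_deriv_le: "\<bar>partial_deriv i W x\<bar> \<le> sqrt (G x)"
  unfolding G_def by (rule real_le_rsqrt) (auto intro: member_le_sum)

lemma G'_le: "\<bar>G' j x\<bar> \<le> 2 * real CARD('n) * C * sqrt (G x)"
proof -
  have "\<bar>G' j x\<bar> \<le> (\<Sum>i\<in>(UNIV::'n set). 2 * (sqrt (G x) * C))"
    unfolding G'_def
  proof (rule order.trans[OF sum_abs], rule sum_mono)
    fix i
    have "\<bar>partial_deriv i W x\<bar> * \<bar>partial_deriv j (partial_deriv i W) x\<bar> \<le> sqrt (G x) * C"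
      by (rule mult_mono[OF partial_deriv_le bound]) (auto simp: G_nonneg)
    then show "\<bar>2 * partial_deriv i W x * partial_deriv j (partial_deriv i W) x\<bar> \<le> 2 * (sqrt (G x) * C)"
      by (simp add: abs_mult)
  qed
  then show ?thesis by (simp add: mult_ac)
qed

lemma growing_W: "growing W"
  "growing (partial_deriv i W)" "growing (partial_deriv j (partial_deriv i W))"
  using W smooth_in_partial_deriv smooth_in_base by metis+

lemma growing_G: "growing G"
  unfolding G_def[abs_def] by (intro growing_sum growing_power growing_W)

lemma growing_G': "growing (G' j)"
  unfolding G'_def[abs_def] by (intro growing_sum growing_mult growing_const growing_W)

lemma growing_S: "growing S"
proof (rule growing_bounded[where C="1 / L"])
  show "continuous_on UNIV S"
    unfolding S_def[abs_def]
    by (intro continuous_intros growing_cont[OF growing_G]) (use L G_nonneg in \<open>smt (verit)\<close>)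
  show "norm (S x) \<le> 1 / L" for x
    using S_le[of x] S_pos[of x] by simp
qed

lemma deriv_W:
  "((\<lambda>s. W (x + s *\<^sub>R axis j 1)) has_real_derivative partial_deriv j W x) (at 0)"
  "((\<lambda>s. partial_deriv i W (x + s *\<^sub>R axis j 1)) has_real_derivative partial_deriv j (partial_deriv i W) x) (at 0)"
  unfolding has_real_derivative_iff_has_vector_derivative
  by (intro has_vector_derivative_partial_deriv smooth_in_differentiable[where Q=growing] W smooth_in_partial_deriv)+

lemma deriv_S:
  "((\<lambda>s. S (x + s *\<^sub>R axis j 1)) has_real_derivative - ((S x)\<^sup>2 * G' j x)) (at 0)"
proof -
  have "((\<lambda>s. G (x + s *\<^sub>R axis j 1)) has_real_derivative G' j x) (at 0)"
    unfolding G_def G'_def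
    by (intro DERIV_sum) (auto intro!: derivative_eq_intros deriv_W)
  moreover have "G x + L \<noteq> 0" using L G_nonneg[of x] by linarith
  ultimately have "((\<lambda>s. inverse (G (x + s *\<^sub>R axis j 1) + L)) has_real_derivative
      - (inverse (G x + L) * G' j x * inverse (G x + L))) (at 0)"
    by (auto intro!: derivative_eq_intros)
  then show ?thesis
    by (simp add: S_def power2_eq_square mult_ac)
qed

text \<open>The derivative of \<open>S * W\<close> in direction \<open>j\<close>, the weight in the
  flux identity.\<close>

definition k' :: "'n \<Rightarrow> real ^ 'n \<Rightarrow> real" where
  "k' j x = S x * partial_deriv j W x - W x * (S x)\<^sup>2 * G' j x"

lemma deriv_k:
  "((\<lambda>s. S (x + s *\<^sub>R axis j 1) * W (x + s *\<^sub>R axis j 1)) has_vector_derivative k' j x) (at 0)"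
  unfolding has_real_derivative_iff_has_vector_derivative[symmetric] k'_def
  by (rule derivative_eq_intros deriv_W deriv_S refl)+ (simp add: algebra_simps)

lemma growing_k': "growing (k' j)"
  unfolding k'_def[abs_def]
  by (intro growing_diff growing_mult growing_power growing_W growing_S growing_G')

text \<open>\<open>d' j\<close> is the derivative of \<open>S \<partial>\<^sub>j W\<close> in direction \<open>j\<close>.\<close>

definition d' :: "'n \<Rightarrow> real ^ 'n \<Rightarrow> real" where
  "d' j x = partial_deriv j (partial_deriv j W) x * S x - partial_deriv j W x * ((S x)\<^sup>2 * G' j x)"

text \<open>The derivative in direction \<open>j\<close> of the \<open>j\<close>-th component of
  \<open>W S \<nabla>W\<close>. Its first term sums to \<open>G * S\<close>, the quantity to be
  estimated; the rest is an error.\<close>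

definition F' :: "'n \<Rightarrow> real ^ 'n \<Rightarrow> real" where
  "F' j x = (partial_deriv j W x)\<^sup>2 * S x + W x * d' j x"

lemma deriv_F:
  "((\<lambda>s. W (x + s *\<^sub>R axis j 1) * (partial_deriv j W (x + s *\<^sub>R axis j 1) * S (x + s *\<^sub>R axis j 1)))
    has_vector_derivative F' j x) (at 0)"
  unfolding has_real_derivative_iff_has_vector_derivative[symmetric] F'_def d'_def
  by (rule derivative_eq_intros deriv_W deriv_S refl)+ (simp add: power2_eq_square algebra_simps)

lemma growing_d': "growing (d' j)"
  unfolding d'_def[abs_def]
  by (intro growing_diff growing_mult growing_power growing_W growing_S growing_G')

lemma growing_F': "growing (F' j)"
  unfolding F'_def[abs_def]
  by (intro growing_add growing_mult growing_power growing_W growing_S growing_d')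

lemma sum_F': "(\<Sum>j\<in>UNIV. F' j x) = G x * S x + W x * (\<Sum>j\<in>UNIV. d' j x)"
  by (simp add: F'_def G_def sum.distrib sum_distrib_left sum_distrib_right)

lemma L2_set_k': "L2_set (\<lambda>j. k' j x) UNIV \<le> 1 / sqrt L + 2 * (real CARD('n))\<^sup>2 * C / L * (sqrt (S x) * \<bar>W x\<bar>)"
proof -
  have G'2: "L2_set (\<lambda>j. G' j x) UNIV \<le> 2 * (real CARD('n))\<^sup>2 * C * sqrt (G x)"
  proof -
    have "L2_set (\<lambda>j. G' j x) UNIV \<le> (\<Sum>j\<in>UNIV. \<bar>G' j x\<bar>)" by (rule L2_set_le_sum_abs)
    also have "\<dots> \<le> (\<Sum>j\<in>(UNIV::'n set). 2 * real CARD('n) * C * sqrt (G x))"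
      by (intro sum_mono G'_le)
    finally show ?thesis by (simp add: power2_eq_square mult_ac)
  qed
  have "L2_set (\<lambda>j. k' j x) UNIV = L2_set (\<lambda>j. S x * partial_deriv j W x + (- W x * (S x)\<^sup>2) * G' j x) UNIV"
    by (simp add: k'_def)
  also have "\<dots> \<le> L2_set (\<lambda>j. S x * partial_deriv j W x) UNIV + L2_set (\<lambda>j. (- W x * (S x)\<^sup>2) * G' j x) UNIV"
    by (rule L2_set_triangle_ineq)
  also have "L2_set (\<lambda>j. S x * partial_deriv j W x) UNIV = S x * sqrt (G x)"
    using S_pos[of x] by (simp add: L2_set_def power_mult_distrib real_sqrt_mult G_def flip: sum_distrib_left)
  also have "L2_set (\<lambda>j. (- W x * (S x)\<^sup>2) * G' j x) UNIV = \<bar>W x\<bar> * (S x)\<^sup>2 * L2_set (\<lambda>j. G' j x) UNIV"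
    by (simp add: L2_set_def power_mult_distrib[of _ "G' _ x"] real_sqrt_mult real_sqrt_abs abs_mult del: mult_minus_left minus_mult_left flip: sum_distrib_left)
  also have "S x * sqrt (G x) \<le> 1 / sqrt L"
    using sqrt_G_S[of x] sqrt_S_le[of x] by (simp add: mult.commute)
  also have "\<bar>W x\<bar> * (S x)\<^sup>2 * L2_set (\<lambda>j. G' j x) UNIV \<le> \<bar>W x\<bar> * (S x)\<^sup>2 * (2 * (real CARD('n))\<^sup>2 * C * sqrt (G x))"
    by (intro mult_left_mono G'2) auto
  \<comment> \<open>Of the two factors \<open>S\<close>, one absorbs \<open>sqrt G\<close> and
    leaves \<open>sqrt S\<close>, the other is bounded by \<open>1 / L\<close>. What remains is
    \<open>sqrt S * \<bar>W\<bar>\<close>, the multiplier in \<open>weighted\<close>.\<close>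
  also have "\<dots> = 2 * (real CARD('n))\<^sup>2 * C * \<bar>W x\<bar> * S x * (sqrt (G x) * S x)"
    by (simp add: power2_eq_square mult_ac)
  also have "\<dots> \<le> 2 * (real CARD('n))\<^sup>2 * C * \<bar>W x\<bar> * (1 / L) * sqrt (S x)"
    using S_pos[of x] C_nonneg G_nonneg[of x] L by (intro mult_mono mult_left_mono S_le sqrt_G_S) auto
  finally show ?thesis by (simp add: mult_ac)
qed

text \<open>The divergence of \<open>S \<nabla>W\<close> is again of size \<open>S\<close>:
  differentiating \<open>\<nabla>W\<close> costs \<open>C\<close>, and differentiating
  \<open>S\<close> costs \<open>C * G * S\<close>, which is at most \<open>C\<close>.\<close>

lemma sum_d'_le: "\<bar>\<Sum>j\<in>UNIV. d' j x\<bar> \<le> (real CARD('n) * C + 2 * (real CARD('n))\<^sup>2 * C) * S x"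
proof -
  have "\<bar>d' j x\<bar> \<le> (C + 2 * real CARD('n) * C) * S x" for j
  proof -
    have "\<bar>d' j x\<bar> \<le> \<bar>partial_deriv j (partial_deriv j W) x * S x\<bar> + \<bar>partial_deriv j W x * ((S x)\<^sup>2 * G' j x)\<bar>"
      unfolding d'_def by (rule abs_triangle_ineq4)
    also have "\<bar>partial_deriv j (partial_deriv j W) x * S x\<bar> \<le> C * S x"
      using S_pos[of x] by (simp add: abs_mult bound)
    also have "\<bar>partial_deriv j W x * ((S x)\<^sup>2 * G' j x)\<bar> = \<bar>partial_deriv j W x\<bar> * ((S x)\<^sup>2 * \<bar>G' j x\<bar>)"
      by (simp add: abs_mult)
    also have "\<dots> \<le> sqrt (G x) * ((S x)\<^sup>2 * (2 * real CARD('n) * C * sqrt (G x)))"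
      by (intro mult_mono mult_left_mono partial_deriv_le G'_le) (auto simp: G_nonneg)
    also have "\<dots> = 2 * real CARD('n) * C * S x * (G x * S x)"
      using G_nonneg[of x] by (simp add: power2_eq_square algebra_simps)
    also have "\<dots> \<le> 2 * real CARD('n) * C * S x * 1"
      using S_pos[of x] C_nonneg card_ge_1 by (intro mult_left_mono G_S_le_1) auto
    finally show ?thesis by (simp add: algebra_simps)
  qed
  then have "\<bar>\<Sum>j\<in>UNIV. d' j x\<bar> \<le> (\<Sum>j\<in>(UNIV::'n set). (C + 2 * real CARD('n) * C) * S x)"
    by (intro order.trans[OF sum_abs] sum_mono)
  then show ?thesis by (simp add: power2_eq_square algebra_simps)
qed

section \<open>The weighted inequalities\<close>

definition weighted :: "(real ^ 'n \<Rightarrow> complex) \<Rightarrow> real ^ 'n \<Rightarrow> complex" where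
  "weighted u x = complex_of_real (sqrt (S x) * W x) * u x"

lemma norm_weighted: "norm (weighted u x) = sqrt (S x) * \<bar>W x\<bar> * norm (u x)"
  using S_pos[of x] by (simp add: weighted_def norm_mult abs_mult)

lemma growing_sqrt_S: "growing (\<lambda>x. sqrt (S x))"
proof (rule growing_bounded[where C="1 / sqrt L"])
  show "continuous_on UNIV (\<lambda>x. sqrt (S x))"
    by (intro continuous_intros growing_cont[OF growing_S])
  show "norm (sqrt (S x)) \<le> 1 / sqrt L" for x
    using sqrt_S_le[of x] S_pos[of x] by simp
qed

lemma rapid_weighted: "rapid u \<Longrightarrow> rapid (weighted u)"
  unfolding weighted_def[abs_def]
  by (rule rapid_mult_growing(1)[OF growing_of_real[OF growing_mult[OF growing_sqrt_S growing_W(1)]]])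

text \<open>In the divergence of \<open>W S \<nabla>W\<close> times the squared modulus of
  \<open>u\<close>, the main term is \<open>G * S\<close> times that square. The term with
  \<open>\<nabla>u\<close> carries \<open>\<bar>W\<bar> * sqrt G * S\<close>, at most
  \<open>\<bar>W\<bar> * sqrt S\<close>; the term with the divergence of \<open>S \<nabla>W\<close>
  carries \<open>\<bar>W\<bar> * S\<close>. Both contain the modulus of
  \<open>weighted u\<close>.\<close>

lemma density_inequality:
  assumes u: "smooth_in rapid u"
  shows "(LINT x|lborel. G x * S x * (norm (u x))\<^sup>2) \<le>
    (real CARD('n) * C + 2 * (real CARD('n))\<^sup>2 * C) / sqrt L * (L2_norm (weighted u) * L2_norm u) +
    2 * (L2_norm (weighted u) * grad_L2_norm u)"
proof -
  note r = smooth_in_rapid_partial_derivs(1,2)[OF u]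
  let ?w = "\<lambda>x. norm (weighted u x)"
  let ?C = "(real CARD('n) * C + 2 * (real CARD('n))\<^sup>2 * C) / sqrt L"
  let ?k = "\<lambda>j x. W x * (partial_deriv j W x * S x)"
  let ?Q = "\<lambda>x. \<Sum>j\<in>UNIV. ?k j x * (2 * Re (cnj (u x) * partial_deriv j u x))"
  have gk: "growing (?k j)" for j
    by (intro growing_mult growing_W growing_S)
  have id: "(LINT x|lborel. (\<Sum>j\<in>UNIV. F' j x) * (norm (u x))\<^sup>2) = - (LINT x|lborel. ?Q x)"
    by (rule density_identity[OF u gk growing_F' deriv_F])
  have rapids: "rapid (\<lambda>x. (\<Sum>j\<in>UNIV. F' j x) * (norm (u x))\<^sup>2)" "rapid ?Q"
    "rapid (\<lambda>x. G x * S x * (norm (u x))\<^sup>2)"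
    "rapid (\<lambda>x. norm (weighted u x) * norm (u x))" "rapid (\<lambda>x. norm (weighted u x) * grad_norm u x)"
    by (intro rapid_mult_growing(1)[OF growing_sum[OF growing_F']] rapid_power2 rapid_norm r
      rapid_sum rapid_mult_growing(1)[OF gk] rapid_mult_growing(1)[OF growing_const]
      rapid_Re rapid_mult rapid_cnj rapid_mult_growing(1)[OF growing_mult[OF growing_G growing_S]]
      rapid_weighted rapid_grad_norm[OF u])+
  note ints = rapids[THEN rapid_integrable]
  \<comment> \<open>Subtracting the full divergence, which has integral zero, reduces the claim to a
    pointwise inequality.\<close>
  have "(LINT x|lborel. G x * S x * (norm (u x))\<^sup>2) =
      (LINT x|lborel. G x * S x * (norm (u x))\<^sup>2 - ((\<Sum>j\<in>UNIV. F' j x) * (norm (u x))\<^sup>2 + ?Q x))"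
    using ints id by simp
  also have "\<dots> \<le> (LINT x|lborel. ?C * (?w x * norm (u x)) + 2 * (?w x * grad_norm u x))"
  proof (rule integral_mono)
    show "integrable lborel (\<lambda>x. G x * S x * (norm (u x))\<^sup>2 - ((\<Sum>j\<in>UNIV. F' j x) * (norm (u x))\<^sup>2 + ?Q x))"
      "integrable lborel (\<lambda>x. ?C * (?w x * norm (u x)) + 2 * (?w x * grad_norm u x))"
      using ints by auto
    fix x
    have "\<bar>\<Sum>j\<in>UNIV. ?k j x * Re (cnj (u x) * partial_deriv j u x)\<bar> \<le> L2_set (\<lambda>j. ?k j x) UNIV * norm (u x) * grad_norm u x"
      by (rule sum_mult_partial_deriv_le) (rule abs_Re_le_cmod)
    also have "L2_set (\<lambda>j. ?k j x) UNIV = \<bar>W x\<bar> * (sqrt (G x) * S x)"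
      using S_pos[of x] by (simp add: L2_set_def power_mult_distrib real_sqrt_mult real_sqrt_abs G_def flip: sum_distrib_left sum_distrib_right)
    also have "\<bar>W x\<bar> * (sqrt (G x) * S x) * norm (u x) * grad_norm u x \<le> \<bar>W x\<bar> * sqrt (S x) * norm (u x) * grad_norm u x"
      by (intro mult_right_mono mult_left_mono sqrt_G_S grad_norm_nonneg) auto
    finally have "\<bar>\<Sum>j\<in>UNIV. ?k j x * Re (cnj (u x) * partial_deriv j u x)\<bar> \<le> ?w x * grad_norm u x"
      unfolding norm_weighted by (simp add: mult_ac)
    moreover have "?Q x = 2 * (\<Sum>j\<in>UNIV. ?k j x * Re (cnj (u x) * partial_deriv j u x))"
      unfolding sum_distrib_left by (intro sum.cong refl) (simp only: mult_ac)
    ultimately have 1: "- ?Q x \<le> 2 * (?w x * grad_norm u x)"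
      by linarith
    have "- (W x * (\<Sum>j\<in>UNIV. d' j x) * (norm (u x))\<^sup>2) \<le> \<bar>W x\<bar> * \<bar>\<Sum>j\<in>UNIV. d' j x\<bar> * (norm (u x))\<^sup>2"
      by (metis abs_ge_minus_self abs_mult abs_power2)
    also have "\<dots> \<le> \<bar>W x\<bar> * ((real CARD('n) * C + 2 * (real CARD('n))\<^sup>2 * C) * S x) * (norm (u x))\<^sup>2"
      by (intro mult_right_mono mult_left_mono sum_d'_le) auto
    also have "\<dots> = (real CARD('n) * C + 2 * (real CARD('n))\<^sup>2 * C) * (?w x * norm (u x)) * sqrt (S x)"
    proof -
      obtain t where t: "sqrt (S x) = t" "S x = t * t"
        using S_pos[of x] by (metis less_imp_le real_sqrt_mult_self abs_of_nonneg)
      show ?thesis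
        unfolding norm_weighted power2_eq_square[of "norm _"] t(1) unfolding t(2) by (simp only: mult_ac)
    qed
    also have "\<dots> \<le> (real CARD('n) * C + 2 * (real CARD('n))\<^sup>2 * C) * (?w x * norm (u x)) * (1 / sqrt L)"
      using C_nonneg card_ge_1 by (intro mult_left_mono sqrt_S_le) auto
    finally have 2: "- (W x * (\<Sum>j\<in>UNIV. d' j x) * (norm (u x))\<^sup>2) \<le> ?C * (?w x * norm (u x))"
      by (simp add: mult_ac)
    show "G x * S x * (norm (u x))\<^sup>2 - ((\<Sum>j\<in>UNIV. F' j x) * (norm (u x))\<^sup>2 + ?Q x) \<le>
        ?C * (?w x * norm (u x)) + 2 * (?w x * grad_norm u x)"
      unfolding sum_F' distrib_right using 1 2 by linarith
  qed
  also have "\<dots> = ?C * (LINT x|lborel. ?w x * norm (u x)) + 2 * (LINT x|lborel. ?w x * grad_norm u x)"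
    using ints by simp
  also have "\<dots> \<le> ?C * (L2_norm (weighted u) * L2_norm u) + 2 * (L2_norm (weighted u) * grad_L2_norm u)"
  proof (intro add_mono mult_left_mono)
    show "(LINT x|lborel. ?w x * norm (u x)) \<le> L2_norm (weighted u) * L2_norm u"
      by (rule integral_mult_le_L2_norm[OF rapid_weighted[OF r(1)] r(1)])
    show "(LINT x|lborel. ?w x * grad_norm u x) \<le> L2_norm (weighted u) * grad_L2_norm u"
      using integral_mult_le_L2_norm[OF rapid_weighted[OF r(1)] rapid_of_real[OF rapid_grad_norm[OF u]]]
      by (simp add: grad_L2_norm_def grad_norm_nonneg)
  qed (use C_nonneg card_ge_1 L in auto)
  finally show ?thesis .
qed

text \<open>Multiply the square of \<open>f\<close> by the weight. The square of the part without
  \<open>W\<close> is dropped, and in the cross term the real potential contributes nothing, which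
  leaves the flux identity with weight \<open>S * W\<close>. Its gradient is controlled by
  \<open>L2_set_k'\<close>.\<close>

lemma weighted_inequality:
  fixes \<alpha> \<rho> :: real
  assumes u: "smooth_in rapid u" and V1: "growing V\<^sub>1"
  defines "f \<equiv> \<lambda>x. - complex_of_real (\<alpha>\<^sup>2) * laplacian u x +
    (complex_of_real (V\<^sub>1 x - \<rho>) + \<i> * complex_of_real (W x)) * u x"
  assumes f: "rapid f"
  shows "(L2_norm (weighted u))\<^sup>2 \<le> (L2_norm f)\<^sup>2 / L +
    2 * \<alpha>\<^sup>2 * (1 / sqrt L * (L2_norm u * grad_L2_norm u) + 2 * (real CARD('n))\<^sup>2 * C / L * (L2_norm (weighted u) * grad_L2_norm u))"
proof -
  note r = smooth_in_rapid_partial_derivs(1,2)[OF u] rapid_laplacian[OF u]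
  let ?w = "\<lambda>x. norm (weighted u x)"
  let ?k = "\<lambda>x. S x * W x"
  let ?J = "\<lambda>x. Im (cnj (u x) * laplacian u x)"
  let ?Q = "\<lambda>x. \<Sum>j\<in>UNIV. k' j x * Im (cnj (u x) * partial_deriv j u x)"
  have gk: "growing ?k"
    by (intro growing_mult growing_W growing_S)
  have id: "(LINT x|lborel. ?k x * ?J x) = - (LINT x|lborel. ?Q x)"
    by (rule flux_identity[OF u gk growing_k' deriv_k])
  have rapids: "rapid (\<lambda>x. ?k x * ?J x)" "rapid ?Q" "rapid (\<lambda>x. (norm (f x))\<^sup>2)" "rapid (\<lambda>x. (?w x)\<^sup>2)"
    "rapid (\<lambda>x. norm (u x) * grad_norm u x)" "rapid (\<lambda>x. ?w x * grad_norm u x)"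
    by (intro rapid_mult_growing(1)[OF gk] rapid_sum rapid_mult_growing(1)[OF growing_k'] f
        rapid_power2 rapid_norm r rapid_Im rapid_mult rapid_cnj rapid_weighted rapid_grad_norm[OF u])+
  note ints = rapids[THEN rapid_integrable]
  have pw: "(?w x)\<^sup>2 \<le> (norm (f x))\<^sup>2 / L + 2 * \<alpha>\<^sup>2 * (?k x * ?J x)" for x
  proof -
    \<comment> \<open>\<open>X\<close> is the part of \<open>f\<close> coming from the real symbol.
      The term \<open>V\<^sub>1 - \<rho>\<close> multiplies the real number
      \<open>cnj u * u\<close>, so it is invisible in the imaginary part below.\<close>
    define X where "X = - complex_of_real (\<alpha>\<^sup>2) * laplacian u x + complex_of_real (V\<^sub>1 x - \<rho>) * u x"
    have fX: "f x = X + \<i> * complex_of_real (W x) * u x"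
      by (simp add: f_def X_def algebra_simps)
    have J: "Im (cnj (u x) * X) = - (\<alpha>\<^sup>2) * ?J x"
      by (simp add: X_def algebra_simps)
    have "(norm (f x))\<^sup>2 = (norm X)\<^sup>2 + (W x)\<^sup>2 * (norm (u x))\<^sup>2 + 2 * W x * Im (cnj (u x) * X)"
      unfolding fX cmod_power2 by (simp add: power2_eq_square algebra_simps)
    moreover have "2 * W x * (- (\<alpha>\<^sup>2) * ?J x) = - (2 * \<alpha>\<^sup>2 * (W x * ?J x))"
      by (simp only: mult_ac mult_minus_left mult_minus_right)
    ultimately have "(W x)\<^sup>2 * (norm (u x))\<^sup>2 - 2 * \<alpha>\<^sup>2 * (W x * ?J x) \<le> (norm (f x))\<^sup>2"
      unfolding J using zero_le_power2[of "norm X"] by linarith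
    then have "S x * ((W x)\<^sup>2 * (norm (u x))\<^sup>2 - 2 * \<alpha>\<^sup>2 * (W x * ?J x)) \<le> S x * (norm (f x))\<^sup>2"
      using S_pos[of x] by (intro mult_left_mono) auto
    moreover have "S x * (norm (f x))\<^sup>2 \<le> (norm (f x))\<^sup>2 / L"
      using mult_right_mono[OF S_le[of x], of "(norm (f x))\<^sup>2"] by simp
    moreover have "(?w x)\<^sup>2 = S x * ((W x)\<^sup>2 * (norm (u x))\<^sup>2)"
      unfolding norm_weighted using S_pos[of x] by (simp add: power_mult_distrib)
    ultimately show ?thesis by (simp add: algebra_simps)
  qed
  have "(L2_norm (weighted u))\<^sup>2 \<le> (LINT x|lborel. (norm (f x))\<^sup>2 / L + 2 * \<alpha>\<^sup>2 * (?k x * ?J x))"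
    unfolding L2_norm_power2 using ints by (intro integral_mono pw) auto
  also have "\<dots> = (L2_norm f)\<^sup>2 / L + 2 * \<alpha>\<^sup>2 * (LINT x|lborel. - ?Q x)"
    using ints id by (simp add: L2_norm_power2)
  also have "(LINT x|lborel. - ?Q x) \<le>
      (LINT x|lborel. 1 / sqrt L * (norm (u x) * grad_norm u x) + 2 * (real CARD('n))\<^sup>2 * C / L * (?w x * grad_norm u x))"
  proof (rule integral_mono)
    show "integrable lborel (\<lambda>x. - ?Q x)"
      "integrable lborel (\<lambda>x. 1 / sqrt L * (norm (u x) * grad_norm u x) + 2 * (real CARD('n))\<^sup>2 * C / L * (?w x * grad_norm u x))"
      using ints by auto
    fix x
    have "- ?Q x \<le> \<bar>?Q x\<bar>" by simp
    also have "\<dots> \<le> L2_set (\<lambda>j. k' j x) UNIV * norm (u x) * grad_norm u x"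
      by (rule sum_mult_partial_deriv_le) (rule abs_Im_le_cmod)
    also have "\<dots> \<le> (1 / sqrt L + 2 * (real CARD('n))\<^sup>2 * C / L * (sqrt (S x) * \<bar>W x\<bar>)) * norm (u x) * grad_norm u x"
      by (intro mult_right_mono L2_set_k' grad_norm_nonneg) auto
    finally show "- ?Q x \<le> 1 / sqrt L * (norm (u x) * grad_norm u x) + 2 * (real CARD('n))\<^sup>2 * C / L * (?w x * grad_norm u x)"
      unfolding norm_weighted distrib_right mult.assoc .
  qed
  also have "\<dots> = 1 / sqrt L * (LINT x|lborel. norm (u x) * grad_norm u x) + 2 * (real CARD('n))\<^sup>2 * C / L * (LINT x|lborel. ?w x * grad_norm u x)"
    using ints by simp
  also have "\<dots> \<le> 1 / sqrt L * (L2_norm u * grad_L2_norm u) + 2 * (real CARD('n))\<^sup>2 * C / L * (L2_norm (weighted u) * grad_L2_norm u)"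
  proof (intro add_mono mult_left_mono)
    show "(LINT x|lborel. norm (u x) * grad_norm u x) \<le> L2_norm u * grad_L2_norm u"
      using integral_mult_le_L2_norm[OF r(1) rapid_of_real[OF rapid_grad_norm[OF u]]]
      by (simp add: grad_L2_norm_def grad_norm_nonneg)
    show "(LINT x|lborel. ?w x * grad_norm u x) \<le> L2_norm (weighted u) * grad_L2_norm u"
      using integral_mult_le_L2_norm[OF rapid_weighted[OF r(1)] rapid_of_real[OF rapid_grad_norm[OF u]]]
      by (simp add: grad_L2_norm_def grad_norm_nonneg)
  qed (use C_nonneg card_ge_1 L in auto)
  finally show ?thesis by (simp add: mult_left_mono)
qed

text \<open>The hypothesis on \<open>B\<close> says that at every point either the gradient of
  \<open>W\<close> or \<open>W\<close> itself is large. The first contribution is the density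
  inequality; the second is bounded directly and accounts for the summand 1 in the constant.\<close>

lemma mass_inequality:
  assumes u: "smooth_in rapid u" and B: "B > 0" "\<And>x. 1 \<le> B * (G x * S x + \<bar>W x\<bar> * S x)"
  shows "(L2_norm u)\<^sup>2 \<le> B * ((real CARD('n) * C + 2 * (real CARD('n))\<^sup>2 * C + 1) / sqrt L * (L2_norm (weighted u) * L2_norm u) +
    2 * (L2_norm (weighted u) * grad_L2_norm u))"
proof -
  note r = smooth_in_rapid_partial_derivs(1,2)[OF u]
  let ?w = "\<lambda>x. norm (weighted u x)"
  have rapids: "rapid (\<lambda>x. G x * S x * (norm (u x))\<^sup>2)" "rapid (\<lambda>x. ?w x * norm (u x))" "rapid (\<lambda>x. (norm (u x))\<^sup>2)"
    by (intro rapid_power2 rapid_norm r rapid_mult rapid_mult_growing(1)[OF growing_mult[OF growing_G growing_S]]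
      rapid_weighted)+
  note ints = rapids[THEN rapid_integrable]
  have pw: "(norm (u x))\<^sup>2 \<le> B * (G x * S x * (norm (u x))\<^sup>2 + 1 / sqrt L * (?w x * norm (u x)))" for x
  proof -
    have "\<bar>W x\<bar> * S x * (norm (u x))\<^sup>2 = sqrt (S x) * (?w x * norm (u x))"
    proof -
      have "S x = sqrt (S x) * sqrt (S x)" using S_pos[of x] by simp
      then show ?thesis unfolding norm_weighted power2_eq_square[of "norm _"] by (simp only: mult_ac)
    qed
    also have "\<dots> \<le> 1 / sqrt L * (?w x * norm (u x))"
      by (intro mult_right_mono sqrt_S_le) auto
    finally have 1: "\<bar>W x\<bar> * S x * (norm (u x))\<^sup>2 \<le> 1 / sqrt L * (?w x * norm (u x))" .
    have "1 * (norm (u x))\<^sup>2 \<le> B * (G x * S x + \<bar>W x\<bar> * S x) * (norm (u x))\<^sup>2"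
      by (intro mult_right_mono B) auto
    also have "\<dots> = B * (G x * S x * (norm (u x))\<^sup>2 + \<bar>W x\<bar> * S x * (norm (u x))\<^sup>2)"
      by (simp add: algebra_simps)
    also have "\<dots> \<le> B * (G x * S x * (norm (u x))\<^sup>2 + 1 / sqrt L * (?w x * norm (u x)))"
      using B(1) 1 by (intro mult_left_mono add_left_mono) auto
    finally show ?thesis by simp
  qed
  have "(L2_norm u)\<^sup>2 \<le> (LINT x|lborel. B * (G x * S x * (norm (u x))\<^sup>2 + 1 / sqrt L * (?w x * norm (u x))))"
    unfolding L2_norm_power2 using ints by (intro integral_mono pw) auto
  also have "\<dots> = B * ((LINT x|lborel. G x * S x * (norm (u x))\<^sup>2) + 1 / sqrt L * (LINT x|lborel. ?w x * norm (u x)))"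
    using ints by simp
  also have "\<dots> \<le> B * (((real CARD('n) * C + 2 * (real CARD('n))\<^sup>2 * C) / sqrt L * (L2_norm (weighted u) * L2_norm u) +
    2 * (L2_norm (weighted u) * grad_L2_norm u)) + 1 / sqrt L * (L2_norm (weighted u) * L2_norm u))"
    using B(1) L by (intro mult_left_mono add_mono density_inequality u integral_mult_le_L2_norm[OF rapid_weighted[OF r(1)] r(1)]) auto
  finally show ?thesis by (simp add: add_divide_distrib algebra_simps)
qed

end

subsection \<open>The resolvent estimate\<close>

lemma partial_deriv_const: "partial_deriv i (\<lambda>x. c) = (\<lambda>x. 0)"
  using partial_deriv_eq[OF has_derivative_const] by blast

lemma smooth_in_growing_const:
  fixes c :: "'b::real_normed_vector"
  shows "smooth_in growing (\<lambda>x::real^'n::finite. c)"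
proof -
  have "smooth_upto growing k (\<lambda>x::real^'n. c)" for k and c :: 'b
    by (induction k arbitrary: c) (auto simp: partial_deriv_const growing_const)
  then show ?thesis by (simp add: smooth_in_def)
qed

text \<open>Here \<open>g\<close>, \<open>n\<close> and \<open>q\<close> are the norms of the
  gradient, of \<open>weighted u\<close> and of \<open>f\<close>, each divided by the norm of
  \<open>u\<close>. The energy inequality makes \<open>g\<close> at most of order
  \<open>\<epsilon> \<kappa> / h\<close>, and the weighted one makes \<open>n\<close> at most of
  order \<open>sqrt \<epsilon> * \<kappa>\<^sup>2 / sqrt L\<close>. Their product has size
  \<open>\<kappa> ^ 3 / (h * sqrt L) = 1\<close> times a small factor, which fixes the exponents 2/3
  and 1/3; the mass inequality then fails.\<close>

lemma scaled_inequalities_contradiction: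
  fixes g n q \<rho> h L \<kappa> B D E \<epsilon> :: real
  assumes pos: "g \<ge> 0" "n \<ge> 0" "q \<ge> 0" "L > 0" "h > 0" "h \<le> L" "\<kappa> > 0" "B > 0" "D \<ge> 0" "E \<ge> 0"
    and \<kappa>: "\<kappa> ^ 3 = h * sqrt L"
    and en: "(h / (2 * pi))\<^sup>2 * g\<^sup>2 \<le> q + \<rho>"
    and wt: "n\<^sup>2 \<le> q\<^sup>2 / L + 2 * (h / (2 * pi))\<^sup>2 * (1 / sqrt L * g + E / L * (n * g))"
    and ms: "1 \<le> B * (D / sqrt L * n + 2 * (n * g))"
    and small: "q < \<epsilon>\<^sup>2 / 2 * \<kappa>\<^sup>2" "\<rho> \<le> \<epsilon>\<^sup>2 / 2 * \<kappa>\<^sup>2"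
    and \<epsilon>: "0 < \<epsilon>" "\<epsilon> \<le> 1" "\<epsilon> * (6 + 4 * E\<^sup>2) * (B * (D + 14))\<^sup>2 < 1"
  shows False
proof -
  define r where "r = sqrt L"
  have r: "r > 0" "L = r\<^sup>2" using pos by (auto simp: r_def)
  define \<alpha> where "\<alpha> = h / (2 * pi)"
  have \<alpha>: "\<alpha> > 0" "\<alpha> \<le> h" "h = 2 * pi * \<alpha>"
    using pos pi_ge_two by (auto simp: \<alpha>_def field_simps)
  \<comment> \<open>The natural size of \<open>n\<close>. The ratio \<open>t\<close> will turn out
    to be of order \<open>sqrt \<epsilon>\<close>.\<close>
  define \<nu> where "\<nu> = \<kappa>\<^sup>2 / r"
  define t where "t = n / \<nu>"
  have \<nu>: "\<nu> > 0" using pos r by (simp add: \<nu>_def)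
  have t: "t \<ge> 0" "n = t * \<nu>" using \<nu> pos by (auto simp: t_def)
  have \<kappa>3: "\<kappa> ^ 3 = h * r" using \<kappa> by (simp add: r_def)
  \<comment> \<open>This is where \<open>h \<le> L\<close> enters: it says that
    \<open>\<kappa> \<le> sqrt L\<close>, which tames the lower-order terms.\<close>
  have "h * r \<le> r ^ 3"
    using mult_right_mono[OF pos(6), of r] r by (simp add: power3_eq_cube power2_eq_square)
  then have "\<kappa> ^ 3 \<le> r ^ 3" by (simp add: \<kappa>3)
  then have \<kappa>r: "\<kappa> \<le> r"
    using r pos by (simp add: power_mono_iff)
  then have \<kappa>r2: "\<kappa>\<^sup>2 / r\<^sup>2 \<le> 1"
    using pos r by (simp add: power_mono)
  have "(\<alpha> * g)\<^sup>2 \<le> (\<epsilon> * \<kappa>)\<^sup>2"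
    using en small unfolding power_mult_distrib \<alpha>_def by linarith
  then have \<alpha>g: "\<alpha> * g \<le> \<epsilon> * \<kappa>"
    by (rule power2_le_imp_le) (use pos \<epsilon> in auto)
  \<comment> \<open>One factor \<open>\<alpha>\<close> is spent on the energy bound, the other is
    estimated by \<open>h = \<kappa> ^ 3 / r\<close>.\<close>
  have "\<alpha>\<^sup>2 * g \<le> h * (\<epsilon> * \<kappa>)"
    using mult_mono[OF \<alpha>(2) \<alpha>g] pos \<alpha> by (simp add: power2_eq_square mult_ac)
  also have "h = \<kappa> ^ 3 / r" using \<kappa>3 r by simp
  finally have \<alpha>2g: "\<alpha>\<^sup>2 * g \<le> \<epsilon> * \<kappa> ^ 4 / r"
    by (simp add: eval_nat_numeral mult_ac)
  have "q\<^sup>2 \<le> (\<epsilon>\<^sup>2 / 2 * \<kappa>\<^sup>2)\<^sup>2"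
    using small pos by (intro power_mono) auto
  also have "\<dots> = (\<epsilon>\<^sup>2 / 2)\<^sup>2 * \<kappa> ^ 4"
    unfolding power_mult_distrib by simp
  also have "\<dots> \<le> \<epsilon> * \<kappa> ^ 4"
  proof (rule mult_right_mono)
    have "\<epsilon>\<^sup>2 \<le> \<epsilon>" using \<epsilon> by (simp add: power2_eq_square mult_left_le_one_le)
    then have "\<epsilon>\<^sup>2 / 2 \<le> 1" "\<epsilon>\<^sup>2 / 2 \<le> \<epsilon>" using \<epsilon> by linarith+
    then have "(\<epsilon>\<^sup>2 / 2) * (\<epsilon>\<^sup>2 / 2) \<le> 1 * \<epsilon>" using \<epsilon> by (intro mult_mono) auto
    then show "(\<epsilon>\<^sup>2 / 2)\<^sup>2 \<le> \<epsilon>" by (simp add: power2_eq_square)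
  qed auto
  finally have "q\<^sup>2 / L \<le> \<epsilon> * \<kappa> ^ 4 / r\<^sup>2"
    using r by (simp add: divide_right_mono)
  also have "\<dots> = \<epsilon> * \<nu>\<^sup>2" by (simp add: \<nu>_def power_divide)
  finally have 1: "q\<^sup>2 / L \<le> \<epsilon> * \<nu>\<^sup>2" .
  have "1 / r * (\<alpha>\<^sup>2 * g) \<le> 1 / r * (\<epsilon> * \<kappa> ^ 4 / r)"
    using r by (intro mult_left_mono \<alpha>2g) auto
  also have "\<dots> = \<epsilon> * \<nu>\<^sup>2" by (simp add: \<nu>_def eval_nat_numeral)
  finally have 2: "1 / r * (\<alpha>\<^sup>2 * g) \<le> \<epsilon> * \<nu>\<^sup>2" .
  have "E / L * n * (\<alpha>\<^sup>2 * g) \<le> E / L * n * (\<epsilon> * \<kappa> ^ 4 / r)"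
    using pos by (intro mult_left_mono \<alpha>2g) auto
  also have "\<dots> = E * \<epsilon> * t * \<nu>\<^sup>2 * (\<kappa>\<^sup>2 / r\<^sup>2)"
    using r by (simp add: t \<nu>_def field_simps eval_nat_numeral)
  also have "\<dots> \<le> E * \<epsilon> * t * \<nu>\<^sup>2 * 1"
    using pos \<epsilon> t by (intro mult_left_mono \<kappa>r2) auto
  finally have 3: "E / L * n * (\<alpha>\<^sup>2 * g) \<le> E * \<epsilon> * t * \<nu>\<^sup>2" by simp
  have "n\<^sup>2 \<le> q\<^sup>2 / L + 2 * (1 / r * (\<alpha>\<^sup>2 * g)) + 2 * (E / L * n * (\<alpha>\<^sup>2 * g))"
    using wt by (simp add: \<alpha>_def r_def algebra_simps)
  also have "\<dots> \<le> \<epsilon> * \<nu>\<^sup>2 + 2 * (\<epsilon> * \<nu>\<^sup>2) + 2 * (E * \<epsilon> * t * \<nu>\<^sup>2)"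
    using 1 2 3 by linarith
  finally have "t\<^sup>2 * \<nu>\<^sup>2 \<le> (3 * \<epsilon> + 2 * E * \<epsilon> * t) * \<nu>\<^sup>2"
    by (simp add: t power_mult_distrib algebra_simps)
  then have t2: "t\<^sup>2 \<le> 3 * \<epsilon> + 2 * E * \<epsilon> * t"
    using \<nu> by simp
  \<comment> \<open>The term linear in \<open>t\<close> is absorbed into half of the square on the
    left after doubling the inequality.\<close>
  moreover have "2 * (2 * E * \<epsilon>) * t \<le> t\<^sup>2 + (2 * E * \<epsilon>)\<^sup>2"
    using zero_le_power2[of "t - 2 * E * \<epsilon>"] by (simp add: power2_eq_square algebra_simps)
  ultimately have "t\<^sup>2 \<le> 6 * \<epsilon> + 4 * E\<^sup>2 * (\<epsilon> * \<epsilon>)"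
    by (simp add: power_mult_distrib power2_eq_square[of \<epsilon>])
  also have "\<dots> \<le> 6 * \<epsilon> + 4 * E\<^sup>2 * (\<epsilon> * 1)"
    using \<epsilon> by (intro add_left_mono mult_left_mono) auto
  finally have t2': "t\<^sup>2 \<le> \<epsilon> * (6 + 4 * E\<^sup>2)" by (simp add: algebra_simps)
  have "n / r = t * (\<kappa>\<^sup>2 / r\<^sup>2)" by (simp add: t \<nu>_def power2_eq_square)
  also have "\<dots> \<le> t" using mult_left_mono[OF \<kappa>r2 t(1)] by simp
  finally have nr: "n / r \<le> t" .
  \<comment> \<open>The product is scale-free: \<open>\<alpha> * r\<close> cancels against
    \<open>\<kappa> ^ 3 = h * r\<close> up to the factor \<open>2 * pi\<close> in
    \<open>h = 2 * pi * \<alpha>\<close>.\<close>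
  have "\<alpha> * r * (n * g) = t * \<kappa>\<^sup>2 * (\<alpha> * g)"
    using r by (simp add: t \<nu>_def)
  also have "\<dots> \<le> t * \<kappa>\<^sup>2 * (\<epsilon> * \<kappa>)"
    using t by (intro mult_left_mono \<alpha>g) auto
  also have "\<dots> = t * \<epsilon> * (h * r)"
    unfolding \<kappa>3[symmetric] by (simp add: eval_nat_numeral)
  also have "\<dots> \<le> t * 1 * (h * r)"
    using t \<epsilon> pos r by (intro mult_right_mono mult_left_mono) auto
  also have "\<dots> = \<alpha> * r * (2 * pi * t)"
    by (subst \<alpha>(3)) simp
  finally have "n * g \<le> 2 * pi * t"
    using \<alpha> r by simp
  \<comment> \<open>7 is an integer above \<open>2 * pi\<close>; doubled in the mass inequality, it
    is the origin of 14 in \<open>D + 14\<close>.\<close>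
  also have "\<dots> \<le> 7 * t"
    using pi_less_4 t pi_approx by (intro mult_right_mono) auto
  finally have ng: "n * g \<le> 7 * t" .
  have "1 \<le> B * (D * (n / r) + 2 * (n * g))" using ms by (simp add: r_def)
  also have "\<dots> \<le> B * (D * t + 2 * (7 * t))"
    using pos by (intro mult_left_mono add_mono nr ng) auto
  also have "\<dots> = B * (D + 14) * t" by (simp add: algebra_simps)
  finally have "1 \<le> (B * (D + 14) * t)\<^sup>2" by (rule one_le_power)
  also have "\<dots> = (B * (D + 14))\<^sup>2 * t\<^sup>2" by (simp add: power_mult_distrib)
  also have "\<dots> \<le> (B * (D + 14))\<^sup>2 * (\<epsilon> * (6 + 4 * E\<^sup>2))"
    by (intro mult_left_mono t2') auto
  also have "\<dots> < 1" using \<epsilon>(3) by (simp add: mult_ac)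
  finally show False by simp
qed

theorem theorem1:
  fixes V :: "real ^ 'n::finite \<Rightarrow> complex"
    and V\<^sub>1 V\<^sub>2 :: "real ^ 'n \<Rightarrow> real"
    and p :: "real ^ 'n \<Rightarrow> real ^ 'n \<Rightarrow> complex"
    and T K :: real
  assumes V_eq: "\<And>x. V x = complex_of_real (V\<^sub>1 x) + \<i> * complex_of_real (V\<^sub>2 x)"
    and V_smooth: "smooth V"
    and p_eq: "\<And>x \<xi>. p x \<xi> = complex_of_real ((norm \<xi>)\<^sup>2) + V x"
    and V1_nonneg: "\<And>x. V\<^sub>1 x \<ge> 0"
    and V2_bound: "\<exists>C>0. \<forall>x. \<bar>V\<^sub>2 x\<bar> \<le> C * (1 + (norm (gradient V\<^sub>2 x))\<^sup>2)"
    and V_derivs: "\<And>is. length is \<ge> 2 \<Longrightarrow> bounded (range (partial_derivs is V))"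
    and T_nonneg: "T \<ge> 0"
    and T_bound: "\<exists>C>0. \<forall>x. \<bar>V\<^sub>2 x\<bar> - T \<le> C * (norm (gradient V\<^sub>2 x))\<^sup>2"
    and K_gt_1: "K > 1"
  shows "\<exists>h\<^sub>0>0. \<exists>A>0. \<exists>M>0. \<exists>c>0.
    \<forall>h z. 0 < h \<longrightarrow> h < h\<^sub>0 \<longrightarrow>
      norm z \<ge> K * T + M * h \<longrightarrow>
      Re z \<le> A * h powr (2/3) * (norm z - T) powr (1/3) \<longrightarrow>
      (\<forall>u\<in>schwartz_space.
         L2_norm (\<lambda>x. weyl_quantization h p u x - z * u x)
           \<ge> c * h powr (2/3) * (norm z - T) powr (1/3) * L2_norm u)"
proof -
  have V: "smooth_in growing V"
    by (rule smooth_in_growing_of_bounded_derivs[OF V_smooth V_derivs])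
  have V1_eq: "V\<^sub>1 = (\<lambda>x. Re (V x))" and V2_eq: "V\<^sub>2 = (\<lambda>x. Im (V x))"
    by (auto simp: V_eq)
  have V1: "growing V\<^sub>1"
    unfolding V1_eq by (rule growing_Re[OF smooth_in_base[OF V]])
  have V2: "smooth_in growing V\<^sub>2"
    unfolding V2_eq by (rule smooth_in_growing_linear[OF bounded_linear_Im V])
  have dd: "partial_deriv j (partial_deriv i V\<^sub>2) = (\<lambda>x. Im (partial_derivs [j, i] V x))" for i j
    unfolding V2_eq
    by (simp add: partial_deriv_linear(1)[OF bounded_linear_Im] smooth_in_differentiable[OF V]
        smooth_in_differentiable[OF smooth_in_partial_deriv[OF V]])
  have "\<exists>C. \<forall>x. norm (partial_derivs [j, i] V x) \<le> C" for i j
    using V_derivs[of "[j, i]"] by (auto simp: bounded_iff)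
  then have "\<exists>c0. \<forall>i j x. norm (partial_derivs [j, i] V x) \<le> c0 i j"
    by (intro choice allI)
  then obtain c0 where c0: "\<And>i j x. norm (partial_derivs [j, i] V x) \<le> c0 i j"
    by blast
  \<comment> \<open>The double sum turns the bounds for the individual second derivatives into one
    constant.\<close>
  define C where "C = (\<Sum>i\<in>UNIV. \<Sum>j\<in>UNIV. \<bar>c0 i j\<bar>)"
  have C: "\<bar>partial_deriv j (partial_deriv i V\<^sub>2) x\<bar> \<le> C" for i j x
  proof -
    have "\<bar>partial_deriv j (partial_deriv i V\<^sub>2) x\<bar> \<le> c0 i j"
      unfolding dd using c0[where x=x] abs_Im_le_cmod order.trans by blast
    also have "\<dots> \<le> (\<Sum>j\<in>UNIV. \<bar>c0 i j\<bar>)"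
      using member_le_sum[of j UNIV "\<lambda>j. \<bar>c0 i j\<bar>"] by simp
    also have "\<dots> \<le> C"
      unfolding C_def using member_le_sum[of i UNIV "\<lambda>i. \<Sum>j\<in>UNIV. \<bar>c0 i j\<bar>"] by (simp add: sum_nonneg)
    finally show ?thesis .
  qed
  have C0: "C \<ge> 0" using C[of undefined undefined 0] by linarith
  obtain C1 where C1: "C1 > 0" "\<And>x. \<bar>V\<^sub>2 x\<bar> - T \<le> C1 * (norm (gradient V\<^sub>2 x))\<^sup>2"
    using T_bound by blast
  have grad: "(norm (gradient V\<^sub>2 x))\<^sup>2 = (\<Sum>i\<in>UNIV. (partial_deriv i V\<^sub>2 x)\<^sup>2)" for x
    unfolding power2_norm_eq_inner inner_vec_def gradient_def by (simp add: power2_eq_square)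
  define N where "N = real CARD('n)"
  \<comment> \<open>Where \<open>G < \<delta> * L\<close>, the assumption on \<open>T\<close> gives
    \<open>\<bar>V\<^sub>2\<bar> \<le> T + L / 4\<close>, leaving a gap of \<open>L / 4\<close> to
    \<open>\<bar>Im z\<bar> \<ge> T + L / 2\<close>.\<close>
  define \<delta> where "\<delta> = 1 / (4 * C1)"
  have \<delta>: "\<delta> > 0" using C1 by (simp add: \<delta>_def)
  \<comment> \<open>The factor must dominate \<open>(1 + \<delta>) / \<delta>\<close> where the
    gradient is large and \<open>4 * (1 + \<delta>)\<close> where it is small.\<close>
  define B where "B = (1 + \<delta>) * (4 + 1 / \<delta>)"
  have B: "B > 0" using \<delta> by (simp add: B_def add_pos_pos)
  define D where "D = N * C + 2 * N\<^sup>2 * C + 1"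
  define E where "E = 2 * N\<^sup>2 * C"
  have DE: "D \<ge> 0" "E \<ge> 0" using C0 by (auto simp: D_def E_def N_def)
  define Q where "Q = (6 + 4 * E\<^sup>2) * (B * (D + 14))\<^sup>2"
  have Q: "Q > 0" unfolding Q_def using B DE by (intro mult_pos_pos zero_less_power add_pos_nonneg add_nonneg_pos) auto
  define \<epsilon> where "\<epsilon> = min 1 (1 / (2 * Q))"
  have \<epsilon>: "0 < \<epsilon>" "\<epsilon> \<le> 1" using Q by (auto simp: \<epsilon>_def)
  have "\<epsilon> * Q \<le> 1 / (2 * Q) * Q" using Q by (intro mult_right_mono) (auto simp: \<epsilon>_def)
  then have "\<epsilon> * Q < 1" using Q by simp
  then have \<epsilon>Q: "\<epsilon> * (6 + 4 * E\<^sup>2) * (B * (D + 14))\<^sup>2 < 1"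
    by (simp only: Q_def mult.assoc)
  \<comment> \<open>The same \<open>c\<close> serves as \<open>A\<close> and as the constant of the
    estimate; \<open>c \<le> 1 / 2\<close> keeps \<open>\<bar>Re z\<bar>\<close> below
    \<open>L / 2\<close>.\<close>
  define c where "c = \<epsilon>\<^sup>2 / 2"
  have c: "c > 0" "c \<le> 1 / 2" using \<epsilon> by (auto simp: c_def power_le_one)
  have main: "c * h powr (2/3) * (norm z - T) powr (1/3) * L2_norm u \<le>
      L2_norm (\<lambda>x. weyl_quantization h p u x - z * u x)"
    if h: "0 < h" and z: "norm z \<ge> K * T + 1 * h"
      and Rez: "Re z \<le> c * h powr (2/3) * (norm z - T) powr (1/3)" and us: "u \<in> schwartz_space"
    for h z and u :: "real ^ 'n \<Rightarrow> complex"
  proof (rule ccontr)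
    assume neg: "\<not> ?thesis"
    have u: "smooth_in rapid u" by (rule schwartz_space_smooth_in_rapid[OF us])
    define L where "L = norm z - T"
    \<comment> \<open>With \<open>M = 1\<close>, the lower bound on \<open>norm z\<close> turns into
      \<open>h \<le> norm z - T\<close>.\<close>
    have "K * T \<ge> 1 * T" using K_gt_1 T_nonneg by (intro mult_right_mono) auto
    then have hL: "h \<le> L" using z by (simp add: L_def)
    then have L: "L > 0" using h by simp
    \<comment> \<open>The square of \<open>\<kappa>\<close> is the claimed lower bound up to the
      constant, and its cube is \<open>h * sqrt L\<close>.\<close>
    define \<kappa> where "\<kappa> = h powr (1/3) * L powr (1/6)"
    have \<kappa>: "\<kappa> > 0" using h L by (simp add: \<kappa>_def)
    have \<kappa>2: "\<kappa>\<^sup>2 = h powr (2/3) * L powr (1/3)"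
      using h L by (simp add: \<kappa>_def power_mult_distrib powr_power)
    have \<kappa>3: "\<kappa> ^ 3 = h * sqrt L"
      using h L by (simp add: \<kappa>_def power_mult_distrib powr_power powr_half_sqrt)
    have "\<kappa>\<^sup>2 \<le> L powr (2/3) * L powr (1/3)"
      unfolding \<kappa>2 using h hL by (intro mult_right_mono powr_mono2) auto
    also have "\<dots> = L" using L by (simp flip: powr_add)
    finally have \<kappa>L: "\<kappa>\<^sup>2 \<le> L" .
    define \<alpha> where "\<alpha> = h / (2 * pi)"
    define \<rho> where "\<rho> = Re z"
    define W where "W = (\<lambda>x. V\<^sub>2 x - Im z)"
    define f where "f = (\<lambda>x. - complex_of_real (\<alpha>\<^sup>2) * laplacian u x +
      (complex_of_real (V\<^sub>1 x - \<rho>) + \<i> * complex_of_real (W x)) * u x)"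
    have "(\<lambda>x. weyl_quantization h p u x - z * u x) = f"
    proof
      fix x
      have "V x - z = complex_of_real (V\<^sub>1 x - \<rho>) + \<i> * complex_of_real (W x)"
        by (simp add: complex_eq_iff V_eq \<rho>_def W_def)
      moreover have "weyl_quantization h p u x - z * u x = - complex_of_real (\<alpha>\<^sup>2) * laplacian u x + (V x - z) * u x"
        unfolding weyl_quantization_schroedinger[OF V u p_eq] \<alpha>_def laplacian_def left_diff_distrib by simp
      ultimately show "weyl_quantization h p u x - z * u x = f x" by (simp only: f_def)
    qed
    with neg have qU: "L2_norm f < c * \<kappa>\<^sup>2 * L2_norm u"
      unfolding \<kappa>2 L_def not_le mult.assoc by metis
    define U where "U = L2_norm u"
    define q where "q = L2_norm f"
    define g where "g = grad_L2_norm u"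
    have U: "U > 0"
    proof (rule ccontr)
      assume "\<not> U > 0"
      then have "L2_norm u = 0" using L2_norm_nonneg[of u] by (simp add: U_def)
      with qU L2_norm_nonneg[of f] show False by simp
    qed
    have \<rho>: "\<rho> \<le> c * \<kappa>\<^sup>2" using Rez by (simp add: \<rho>_def \<kappa>2 L_def)
    have W: "smooth_in growing W"
    proof -
      have "smooth_in growing (\<lambda>x. V\<^sub>2 x + - Im z)"
        by (rule smooth_in_add[where Q=growing, OF growing_add V2 smooth_in_growing_const])
      then show ?thesis by (simp add: W_def)
    qed
    have dW: "partial_deriv i W = partial_deriv i V\<^sub>2" for i
      using partial_deriv_add[of V\<^sub>2 "\<lambda>x. - Im z" i] smooth_in_differentiable[OF V2]
      by (simp add: W_def partial_deriv_const)
    interpret gradient_weight W L C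
      by unfold_locales (use W L C in \<open>auto simp: dW\<close>)
    have rf: "rapid f" and en: "\<alpha>\<^sup>2 * g\<^sup>2 \<le> q * U + \<rho> * U\<^sup>2"
      unfolding f_def q_def U_def g_def
      by (rule energy_inequality[OF u V1 V1_nonneg smooth_in_base[OF W]])+
    \<comment> \<open>Only an upper bound on \<open>Re z\<close> is assumed. The energy inequality
      has a nonnegative left side, so a small \<open>f\<close> also excludes very negative
      \<open>Re z\<close>.\<close>
    have "0 \<le> q * U + \<rho> * U\<^sup>2" by (rule order.trans[OF _ en]) simp
    also have "\<dots> \<le> (c * \<kappa>\<^sup>2 * U) * U + \<rho> * U\<^sup>2"
      using qU U by (intro add_right_mono mult_right_mono) (auto simp: q_def U_def)
    also have "\<dots> = (c * \<kappa>\<^sup>2 + \<rho>) * U\<^sup>2" by (simp add: power2_eq_square algebra_simps)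
    finally have "- (c * \<kappa>\<^sup>2) \<le> \<rho>"
      using U by (simp add: zero_le_mult_iff)
    with \<rho> have "\<bar>\<rho>\<bar> \<le> c * \<kappa>\<^sup>2" by linarith
    \<comment> \<open>With \<open>Re z\<close> at most \<open>L / 2\<close> in modulus, the size of
      \<open>z\<close> must come from its imaginary part.\<close>
    also have "\<dots> \<le> 1 / 2 * L" using c \<kappa>L by (intro mult_mono) auto
    finally have Imz: "\<bar>Im z\<bar> \<ge> T + L / 2"
      using cmod_le[of z] unfolding \<rho>_def L_def by argo
    have GV: "G x = (norm (gradient V\<^sub>2 x))\<^sup>2" for x
      by (simp add: G_def grad dW)
    \<comment> \<open>Where the gradient is large, \<open>G * S\<close> is bounded below; where it
      is small, \<open>S\<close> is comparable to \<open>1 / L\<close> and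
      \<open>\<bar>W\<bar>\<close> is at least \<open>L / 4\<close>.\<close>
    have low: "1 \<le> B * (G x * S x + \<bar>W x\<bar> * S x)" for x
    proof (cases "G x \<ge> \<delta> * L")
      case True
      have "B * (G x * S x) \<ge> (1 + \<delta>) / \<delta> * (G x * S x)"
        using \<delta> G_nonneg[of x] S_pos[of x] by (intro mult_right_mono) (auto simp: B_def field_simps)
      moreover have "(1 + \<delta>) / \<delta> * (G x * S x) \<ge> 1"
      proof -
        have "\<delta> * (G x + L) \<le> (1 + \<delta>) * G x" using True by (simp add: algebra_simps)
        moreover have "\<delta> * (G x + L) > 0" using \<delta> G_nonneg[of x] L by simp
        ultimately have "1 \<le> (1 + \<delta>) * G x / (\<delta> * (G x + L))" by simp
        then show ?thesis by (simp add: S_def divide_inverse mult_ac)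
      qed
      moreover have "B * (\<bar>W x\<bar> * S x) \<ge> 0" using B S_pos[of x] by simp
      ultimately show ?thesis by (simp add: distrib_left)
    next
      case False
      have "C1 * G x \<le> C1 * (\<delta> * L)" using False C1 by (intro mult_left_mono) auto
      also have "\<dots> = L / 4" using C1 by (simp add: \<delta>_def)
      finally have "\<bar>V\<^sub>2 x\<bar> \<le> T + L / 4" using C1(2)[of x] by (simp add: GV)
      then have W4: "\<bar>W x\<bar> \<ge> L / 4" using Imz unfolding W_def by linarith
      have "(1 + \<delta>) * L * S x \<ge> 1"
        using False L G_nonneg[of x] by (simp add: S_def field_simps)
      then have "1 \<le> (1 + \<delta>) * 4 * (L / 4 * S x)" by (simp add: algebra_simps)
      also have "\<dots> \<le> (1 + \<delta>) * 4 * (\<bar>W x\<bar> * S x)"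
        using \<delta> S_pos[of x] W4 by (intro mult_left_mono mult_right_mono) auto
      also have "\<dots> \<le> B * (\<bar>W x\<bar> * S x)"
      proof (rule mult_right_mono)
        show "(1 + \<delta>) * 4 \<le> B"
          unfolding B_def using \<delta> by (intro mult_left_mono) auto
      qed (use S_pos[of x] in simp)
      finally have "1 \<le> B * (\<bar>W x\<bar> * S x)" .
      moreover have "B * (G x * S x) \<ge> 0" using B S_pos[of x] G_nonneg[of x] by simp
      ultimately show ?thesis by (simp add: distrib_left)
    qed
    define n where "n = L2_norm (weighted u)"
    have wt: "n\<^sup>2 \<le> q\<^sup>2 / L + 2 * \<alpha>\<^sup>2 * (1 / sqrt L * (U * g) + E / L * (n * g))"
      using weighted_inequality[OF u V1 rf[unfolded f_def]]
      by (simp only: n_def q_def f_def U_def g_def E_def N_def)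
    have ms: "U\<^sup>2 \<le> B * (D / sqrt L * (n * U) + 2 * (n * g))"
      using mass_inequality[OF u B low] by (simp only: n_def U_def g_def D_def N_def)
    have nn: "g \<ge> 0" "n \<ge> 0" "q \<ge> 0"
      by (simp_all add: g_def grad_L2_norm_def n_def q_def L2_norm_nonneg)
    show False
    \<comment> \<open>All three inequalities are homogeneous in \<open>u\<close> and are divided by
      the square of its norm.\<close>
    proof (rule scaled_inequalities_contradiction[where g="g / U" and n="n / U" and q="q / U" and \<rho>=\<rho> and h=h and L=L
          and \<kappa>=\<kappa> and B=B and D=D and E=E and \<epsilon>=\<epsilon>])
      show "(h / (2 * pi))\<^sup>2 * (g / U)\<^sup>2 \<le> q / U + \<rho>"
        using divide_right_mono[OF en, of "U\<^sup>2"] U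
        by (simp add: \<alpha>_def add_divide_distrib power_divide power2_eq_square)
      show "(n / U)\<^sup>2 \<le> (q / U)\<^sup>2 / L + 2 * (h / (2 * pi))\<^sup>2 * (1 / sqrt L * (g / U) + E / L * (n / U * (g / U)))"
      proof -
        have "(n / U)\<^sup>2 = n\<^sup>2 / U\<^sup>2" by (simp add: power_divide)
        also have "\<dots> \<le> (q\<^sup>2 / L + 2 * \<alpha>\<^sup>2 * (1 / sqrt L * (U * g) + E / L * (n * g))) / U\<^sup>2"
          by (rule divide_right_mono[OF wt]) simp
        also have "\<dots> = (q / U)\<^sup>2 / L + 2 * \<alpha>\<^sup>2 * (1 / sqrt L * (g / U) + E / L * (n / U * (g / U)))"
          using U by (simp add: add_divide_distrib distrib_left power_divide power2_eq_square mult_ac)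
        finally show ?thesis unfolding \<alpha>_def .
      qed
      show "1 \<le> B * (D / sqrt L * (n / U) + 2 * (n / U * (g / U)))"
      proof -
        have "1 = U\<^sup>2 / U\<^sup>2" using U by simp
        also have "\<dots> \<le> B * (D / sqrt L * (n * U) + 2 * (n * g)) / U\<^sup>2"
          by (rule divide_right_mono[OF ms]) simp
        also have "\<dots> = B * (D / sqrt L * (n / U) + 2 * (n / U * (g / U)))"
          using U by (simp add: add_divide_distrib distrib_left power2_eq_square)
        finally show ?thesis .
      qed
      show "q / U < \<epsilon>\<^sup>2 / 2 * \<kappa>\<^sup>2"
        using qU U by (simp add: q_def U_def c_def field_simps)
      show "\<rho> \<le> \<epsilon>\<^sup>2 / 2 * \<kappa>\<^sup>2" using \<rho> by (simp add: c_def)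
    qed (use nn U L h hL \<kappa> B DE \<kappa>3 \<epsilon> \<epsilon>Q in auto)
  qed
  show ?thesis
    \<comment> \<open>The witnesses are 1 for \<open>h\<^sub>0\<close> and \<open>M\<close>, and
      \<open>c\<close> for \<open>A\<close> and for the constant of the estimate.\<close>
    by (rule exI[of _ 1], intro conjI, simp, rule exI[of _ c], intro conjI, fact c,
        rule exI[of _ 1], intro conjI, simp, rule exI[of _ c], intro conjI, fact c)
      (use main in blast)
qed

end
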